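(* Let $X$ and $Y$ be connected complex manifolds, with $X$ non-compact, let $\mathbf{F}$ be a normed space of holomorphic functions (NSHF) over $X$ and let $\mathbf{E}$ be an NSHF over $Y$. Let $\Phi:Y\to X$ and $\omega:Y\to\mathbb{C}\setminus\{0\}$ be arbitrary (not necessarily continuous) maps. (i) If $\mathbf{F}$ generates the topology of $X$, and $C_{\Phi}$ maps $\mathbf{F}$ into $\mathbf{E}$ and is continuous, then $\Phi$ is holomorphic. (ii) If $\mathbf{F}$ is $2$-independent, generates the topology of $X$ and contains a non-zero constant function, and $W_{\Phi,\omega}$ maps $\mathbf{F}$ into $\mathbf{E}$ and is continuous, then $W_{\Phi,\omega}:\mathbf{F}\to\mathbf{E}$ is a holomorphically induced weighted composition operator. (iii) If $\mathbf{F}$ and $\mathbf{E}$ are $2$-independent, the bounded functions belonging to $\mathbf{F}$ form a dense set in $\mathbf{F}$, $\lim\limits_{x\to\infty}|\kappa|_{\mathbf{F}}(x)=+\infty$, and $W_{\Phi,\omega}$ maps $\mathbf{F}$ into $\mathbf{E}$ and is continuous, then $W_{\Phi,\omega}:\mathbf{F}\to\mathbf{E}$ is a holomorphically induced weighted composition operator.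
   Context: Manifolds are Hausdorff, connected and without boundary. Scalars are $\mathbb{C}$. A normed space of holomorphic functions (NSHF) over a complex manifold $X$ is a linear subspace $\mathbf{F}$ of the space $\mathcal{H}(X)$ of holomorphic functions on $X$, equipped with a norm such that the inclusion of $\mathbf{F}$ into the space $\mathcal{C}(X)$ of continuous functions with the compact-open topology is continuous. For maps $\Phi:Y\to X$, $\omega:Y\to\mathbb{C}$ and $f:X\to\mathbb{C}$: $[W_{\Phi,\omega}f](y)=\omega(y)f(\Phi(y))$, and $C_\Phi=W_{\Phi,1}$. The operator $W_{\Phi,\omega}:\mathbf{F}\to\mathbf{E}$ is a holomorphically induced weighted composition operator if there are holomorphic $\Phi':Y\to X$ and $\omega':Y\to\mathbb{C}$ such that $W_{\Phi,\omega}f=W_{\Phi',\omega'}f$ for every $f\in\mathbf{F}$. $\mathbf{F}$ generates the topology of $X$ if the topology of $X$ coincides with the smallest topology on $X$ making all elements of $\mathbf{F}$ continuous. For $x\in X$, $x_{\mathbf{F}}\in\mathbf{F}^*$ is the point evaluation $x_{\mathbf{F}}(f)=f(x)$, and $|\kappa|_{\mathbf{F}}(x)=\|x_{\mathbf{F}}\|$. $\mathbf{F}$ is $2$-independent if $x_{\mathbf{F}}$ and $y_{\mathbf{F}}$ are linearly independent for every distinct $x,y\in X$ (similarly for $\mathbf{E}$ over $Y$). $\lim_{x\to\infty}|\kappa|_{\mathbf{F}}(x)=+\infty$ means that for every $R>0$ there is a compact $K\subset X$ with $|\kappa|_{\mathbf{F}}(x)>R$ for all $x\notin K$. *)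

theory Defs
  imports "HOL-Analysis.Analysis"
begin

section \<open>Complex manifolds\<close>

text \<open>
  Complex differentiability at every point: the Frechet derivative exists and is complex linear.
  It is only applied to sets \<open>S\<close> that are open in the model space of a manifold.
\<close>

definition holo_on :: "(complex^'n) set \<Rightarrow> (complex^'n \<Rightarrow> complex) \<Rightarrow> bool" where
  "holo_on S f \<longleftrightarrow>
     (\<forall>z\<in>S. \<exists>D. (f has_derivative D) (at z within S) \<and> (\<forall>c v. D (c *s v) = c * D v))"

text \<open>
  A manifold is the universe of a type of class \<open>t2_space\<close> (hence Hausdorff and nonempty), together
  with an atlas: a set of charts \<open>(U, \<phi>)\<close>, where only the values of \<open>\<phi>\<close> on \<open>U\<close> matter. Second
  countability is not required.

  The model space \<open>V\<close> is all of \<open>complex^'n\<close>, whose dimension is at least \<open>1\<close>, or the zero space;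
  the latter accounts for the manifold of dimension \<open>0\<close>. By connectedness one model space suffices.
\<close>

type_synonym ('a, 'n) atlas = "('a set \<times> ('a \<Rightarrow> complex^'n)) set"

definition chart :: "(complex^'n) set \<Rightarrow> ('a::topological_space) set \<Rightarrow> ('a \<Rightarrow> complex^'n) \<Rightarrow> bool" where
  "chart V U \<phi> \<longleftrightarrow> open U \<and> openin (top_of_set V) (\<phi> ` U) \<and> homeomorphism U (\<phi> ` U) \<phi> (inv_into U \<phi>)"

definition complex_manifold :: "('a::t2_space, 'n::finite) atlas \<Rightarrow> bool" where
  "complex_manifold A \<longleftrightarrow>
     connected (UNIV :: 'a set) \<and>
     (\<exists>V. (V = UNIV \<or> V = {0}) \<and> (\<forall>(U, \<phi>)\<in>A. chart V U \<phi>)) \<and>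
     (\<Union>(U, \<phi>)\<in>A. U) = UNIV \<and>
     (\<forall>(U, \<phi>)\<in>A. \<forall>(W, \<psi>)\<in>A. \<forall>i. holo_on (\<phi> ` (U \<inter> W)) (\<lambda>z. \<psi> (inv_into U \<phi> z) $ i))"

definition holomorphic_fun :: "('a::t2_space, 'n::finite) atlas \<Rightarrow> ('a \<Rightarrow> complex) \<Rightarrow> bool" where
  "holomorphic_fun A f \<longleftrightarrow> (\<forall>(U, \<phi>)\<in>A. holo_on (\<phi> ` U) (\<lambda>z. f (inv_into U \<phi> z)))"

definition holomorphic_map ::
  "('b::t2_space, 'm::finite) atlas \<Rightarrow> ('a::t2_space, 'n::finite) atlas \<Rightarrow> ('b \<Rightarrow> 'a) \<Rightarrow> bool" where
  "holomorphic_map B A \<Phi> \<longleftrightarrow>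
     continuous_on UNIV \<Phi> \<and>
     (\<forall>(U, \<phi>)\<in>B. \<forall>(W, \<psi>)\<in>A. \<forall>i.
        holo_on (\<phi> ` (U \<inter> \<Phi> -` W)) (\<lambda>z. \<psi> (\<Phi> (inv_into U \<phi> z)) $ i))"


section \<open>Normed spaces of holomorphic functions\<close>

text \<open>
  A normed space of functions is a set \<open>F\<close> of functions closed under the pointwise operations, with
  a norm \<open>N\<close> of which only the values on \<open>F\<close> matter.
\<close>

definition normed_function_space :: "('a \<Rightarrow> complex) set \<Rightarrow> (('a \<Rightarrow> complex) \<Rightarrow> real) \<Rightarrow> bool" where
  "normed_function_space F N \<longleftrightarrow>
     (\<lambda>x. 0) \<in> F \<and>
     (\<forall>f\<in>F. \<forall>g\<in>F. (\<lambda>x. f x + g x) \<in> F) \<and>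
     (\<forall>c. \<forall>f\<in>F. (\<lambda>x. c * f x) \<in> F) \<and>
     (\<forall>f\<in>F. 0 \<le> N f) \<and>
     (\<forall>f\<in>F. N f = 0 \<longleftrightarrow> f = (\<lambda>x. 0)) \<and>
     (\<forall>c. \<forall>f\<in>F. N (\<lambda>x. c * f x) = cmod c * N f) \<and>
     (\<forall>f\<in>F. \<forall>g\<in>F. N (\<lambda>x. f x + g x) \<le> N f + N g)"

text \<open>
  The locale \<open>Metric_space\<close> asks for nonnegativity and symmetry off the carrier too, hence the
  conditional.
\<close>

definition norm_dist ::
  "('a \<Rightarrow> complex) set \<Rightarrow> (('a \<Rightarrow> complex) \<Rightarrow> real) \<Rightarrow> ('a \<Rightarrow> complex) \<Rightarrow> ('a \<Rightarrow> complex) \<Rightarrow> real" where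
  "norm_dist F N f g = (if f \<in> F \<and> g \<in> F then N (\<lambda>x. f x - g x) else 0)"

definition norm_topology ::
  "('a \<Rightarrow> complex) set \<Rightarrow> (('a \<Rightarrow> complex) \<Rightarrow> real) \<Rightarrow> ('a \<Rightarrow> complex) topology" where
  "norm_topology F N = Metric_space.mtopology F (norm_dist F N)"

lemma Metric_space_norm_dist:
  assumes "normed_function_space F N"
  shows "Metric_space F (norm_dist F N)"
proof -
  have add: "(\<lambda>x. f x + g x) \<in> F" "N (\<lambda>x. f x + g x) \<le> N f + N g" if "f \<in> F" "g \<in> F" for f g
    using assms that unfolding normed_function_space_def by blast+
  have scale: "(\<lambda>x. c * f x) \<in> F" "N (\<lambda>x. c * f x) = cmod c * N f" if "f \<in> F" for c f
    using assms that unfolding normed_function_space_def by blast+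
  have nonneg: "0 \<le> N f" and zero: "N f = 0 \<longleftrightarrow> f = (\<lambda>x. 0)" if "f \<in> F" for f
    using assms that unfolding normed_function_space_def by blast+
  have diff: "(\<lambda>x. f x - g x) \<in> F" if "f \<in> F" "g \<in> F" for f g
    using add(1)[OF that(1) scale(1)[OF that(2), of "-1"]] by simp
  show ?thesis
  proof
    show "0 \<le> norm_dist F N f g" for f g
      by (simp add: norm_dist_def nonneg diff)
    show "norm_dist F N f g = norm_dist F N g f" for f g
      using scale(2)[of "\<lambda>x. f x - g x" "-1"] diff by (auto simp: norm_dist_def)
    show "norm_dist F N f g = 0 \<longleftrightarrow> f = g" if "f \<in> F" "g \<in> F" for f g
      using zero[OF diff[OF that]] that by (auto simp: norm_dist_def fun_eq_iff)
    show "norm_dist F N f h \<le> norm_dist F N f g + norm_dist F N g h"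
      if "f \<in> F" "g \<in> F" "h \<in> F" for f g h
      using add(2)[OF diff[OF that(1,2)] diff[OF that(2,3)]] that by (simp add: norm_dist_def)
  qed
qed

text \<open>The case \<open>K = {}\<close> makes the carrier all of \<open>C(X)\<close>.\<close>

definition compact_open_topology :: "('a::topological_space \<Rightarrow> complex) topology" where
  "compact_open_topology =
     topology_generated_by {{f. continuous_on UNIV f \<and> f ` K \<subseteq> U} | K U. compact K \<and> open U}"

definition nshf ::
  "('a::t2_space, 'n::finite) atlas \<Rightarrow> ('a \<Rightarrow> complex) set \<Rightarrow> (('a \<Rightarrow> complex) \<Rightarrow> real) \<Rightarrow> bool" where
  "nshf A F N \<longleftrightarrow>
     normed_function_space F N \<and>
     (\<forall>f\<in>F. holomorphic_fun A f) \<and>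
     continuous_map (norm_topology F N) compact_open_topology (\<lambda>f. f)"

definition generates_topology :: "('a::topological_space \<Rightarrow> complex) set \<Rightarrow> bool" where
  "generates_topology F \<longleftrightarrow>
     (open :: 'a set \<Rightarrow> bool) = generate_topology {f -` V | f V. f \<in> F \<and> open V}"

definition point_eval :: "'a \<Rightarrow> ('a \<Rightarrow> complex) \<Rightarrow> complex" where
  "point_eval x f = f x"

text \<open>The norm of the dual space; the supremum is finite for continuous functionals.\<close>

definition dual_norm ::
  "('a \<Rightarrow> complex) set \<Rightarrow> (('a \<Rightarrow> complex) \<Rightarrow> real) \<Rightarrow> (('a \<Rightarrow> complex) \<Rightarrow> complex) \<Rightarrow> real" where
  "dual_norm F N L = (SUP f\<in>{f\<in>F. N f \<le> 1}. cmod (L f))"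

definition kappa :: "('a \<Rightarrow> complex) set \<Rightarrow> (('a \<Rightarrow> complex) \<Rightarrow> real) \<Rightarrow> 'a \<Rightarrow> real" where
  "kappa F N x = dual_norm F N (point_eval x)"

definition kappa_tends_to_infinity ::
  "('a::topological_space \<Rightarrow> complex) set \<Rightarrow> (('a \<Rightarrow> complex) \<Rightarrow> real) \<Rightarrow> bool" where
  "kappa_tends_to_infinity F N \<longleftrightarrow> (\<forall>R>0. \<exists>K. compact K \<and> (\<forall>x. x \<notin> K \<longrightarrow> kappa F N x > R))"

text \<open>Linear independence is meant in the dual space, that is, as functionals on \<open>F\<close>.\<close>

definition two_independent :: "('a \<Rightarrow> complex) set \<Rightarrow> bool" where
  "two_independent F \<longleftrightarrow>
     (\<forall>x y. x \<noteq> y \<longrightarrow>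
        (\<forall>a b. (\<forall>f\<in>F. a * point_eval x f + b * point_eval y f = 0) \<longrightarrow> a = 0 \<and> b = 0))"

definition bounded_functions_dense ::
  "('a \<Rightarrow> complex) set \<Rightarrow> (('a \<Rightarrow> complex) \<Rightarrow> real) \<Rightarrow> bool" where
  "bounded_functions_dense F N \<longleftrightarrow>
     (norm_topology F N) closure_of {f\<in>F. bounded (range f)} = F"


section \<open>Weighted composition operators\<close>

definition wcomp :: "('b \<Rightarrow> 'a) \<Rightarrow> ('b \<Rightarrow> complex) \<Rightarrow> ('a \<Rightarrow> complex) \<Rightarrow> 'b \<Rightarrow> complex" where
  "wcomp \<Phi> \<omega> f = (\<lambda>y. \<omega> y * f (\<Phi> y))"

definition comp_op :: "('b \<Rightarrow> 'a) \<Rightarrow> ('a \<Rightarrow> complex) \<Rightarrow> 'b \<Rightarrow> complex" where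
  "comp_op \<Phi> = wcomp \<Phi> (\<lambda>y. 1)"

definition continuous_operator ::
  "('a \<Rightarrow> complex) set \<Rightarrow> (('a \<Rightarrow> complex) \<Rightarrow> real) \<Rightarrow> ('b \<Rightarrow> complex) set \<Rightarrow> (('b \<Rightarrow> complex) \<Rightarrow> real)
    \<Rightarrow> (('a \<Rightarrow> complex) \<Rightarrow> ('b \<Rightarrow> complex)) \<Rightarrow> bool" where
  "continuous_operator F NF E NE T \<longleftrightarrow>
     T ` F \<subseteq> E \<and> continuous_map (norm_topology F NF) (norm_topology E NE) T"

definition holomorphically_induced ::
  "('b::t2_space, 'm::finite) atlas \<Rightarrow> ('a::t2_space, 'n::finite) atlas \<Rightarrow> ('a \<Rightarrow> complex) set
    \<Rightarrow> ('b \<Rightarrow> 'a) \<Rightarrow> ('b \<Rightarrow> complex) \<Rightarrow> bool" where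
  "holomorphically_induced B A F \<Phi> \<omega> \<longleftrightarrow>
     (\<exists>\<Phi>' \<omega>'. holomorphic_map B A \<Phi>' \<and> holomorphic_fun B \<omega>' \<and>
        (\<forall>f\<in>F. wcomp \<Phi> \<omega> f = wcomp \<Phi>' \<omega>' f))"

end

theory Submission
  imports Defs "HOL-Complex_Analysis.Great_Picard"
begin

text \<open>
  In all three parts \<open>\<Phi>\<close> is continuous, \<open>\<omega>\<close> has no zeros and \<open>\<omega> * f \<circ> \<Phi>\<close> is holomorphic for
  all \<open>f\<close> in a family that separates the points of \<open>X\<close> projectively; the family is \<open>F\<close>, enlarged by
  the constants in (i). In (iii) continuity of \<open>\<Phi>\<close> comes from the growth of \<open>kappa\<close>, which keeps
  \<open>\<Phi>\<close> locally in a compact set.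

  The members of the family may fail to be local coordinates along the whole image of \<open>\<Phi>\<close>, as
  \<open>z^2, z^3\<close> do at the origin. It is therefore enlarged to the algebra of all functions \<open>g\<close> on a chart
  of \<open>X\<close> with \<open>g \<circ> \<Phi>\<close> holomorphic on a given complex line in a chart of \<open>Y\<close>. This algebra contains
  the functions that vanish on the image, hence those Jacobians of its members that do so, and this
  forces it to contain a coordinate system with Jacobian \<open>J\<close> not identically zero on the image. Then
  \<open>\<Phi>\<close> is holomorphic where \<open>J \<circ> \<Phi> \<noteq> 0\<close>, and everywhere by Rado's theorem.
\<close>

section \<open>Rado's theorem\<close>

text \<open>The obstacle is that only continuity of \<Phi> is at hand: neither its rank nor the
  shape of its image is known, so the common critical locus of the family cannot be escaped by a
  dimension count or by moving to a generic point. Enlarging the family to the algebra of all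
  functions with holomorphic pullback answers this, as a Jacobian that vanishes on the image then
  belongs to the algebra instead of being an obstruction.

  The algebra is formed on one complex line at a time. This leaves a single complex variable, in
  which Rado's theorem asks nothing of the zero set of J \<circ> \<Phi> except that it is not
  everything; Osgood's lemma then puts the lines together.

  Projective separation is the right notion because the unknown weight \<omega> cancels in quotients
  \<open>f / g\<close>. For parts (ii) and (iii) it is what 2-independence gives; in (i) the added
  constant 1 turns separation of points into projective separation.\<close>

lemma open_nonzero_set:
  fixes g :: "complex \<Rightarrow> complex"
  assumes "continuous_on S g" "open S"
  shows "open {z\<in>S. g z \<noteq> 0}"
proof -
  have "open (S \<inter> g -` (-{0}))"
    using assms by (intro continuous_open_preimage) auto
  moreover have "S \<inter> g -` (-{0}) = {z\<in>S. g z \<noteq> 0}" by auto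
  ultimately show ?thesis by simp
qed

text \<open>Where \<open>g = 0\<close> the functions \<open>h^n * g\<close> vanish, so the maximum principle bounds them by their
  values on the circle alone; now let \<open>n\<close> tend to infinity.\<close>

lemma max_modulus_off_zeros:
  fixes g h :: "complex \<Rightarrow> complex"
  assumes cont: "continuous_on (cball 0 1) g" "continuous_on (cball 0 1) h"
    and holo: "g holomorphic_on {z\<in>ball 0 1. g z \<noteq> 0}" "h holomorphic_on {z\<in>ball 0 1. g z \<noteq> 0}"
    and M: "\<And>z. cmod z = 1 \<Longrightarrow> cmod (h z) \<le> M"
    and a: "a \<in> ball 0 1" "g a \<noteq> 0"
  shows "cmod (h a) \<le> M"
proof (rule ccontr)
  assume less: "\<not> cmod (h a) \<le> M"
  define \<Omega> where "\<Omega> = {z\<in>ball 0 1. g z \<noteq> 0}"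
  have op: "open \<Omega>"
    unfolding \<Omega>_def using continuous_on_subset[OF cont(1)] by (intro open_nonzero_set) auto
  have sub: "closure \<Omega> \<subseteq> cball 0 1"
    by (rule closure_minimal) (auto simp: \<Omega>_def)
  obtain C where C: "\<And>z. z \<in> cball 0 1 \<Longrightarrow> cmod (g z) \<le> C"
    using compact_continuous_image[OF cont(1) compact_cball, THEN compact_imp_bounded]
    unfolding bounded_iff by blast
  have C0: "0 \<le> C" using C[of 0] by (auto intro: order_trans[OF norm_ge_zero])
  have M0: "0 \<le> M" using M[of 1] by (auto intro: order_trans[OF norm_ge_zero])
  have bound: "cmod (h a) ^ n * cmod (g a) \<le> M ^ n * C" for n
  proof -
    have "cmod (h a ^ n * g a) \<le> M ^ n * C"
    proof (rule maximum_modulus_frontier[of "\<lambda>z. h z ^ n * g z" \<Omega>])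
      show "(\<lambda>z. h z ^ n * g z) holomorphic_on interior \<Omega>"
        using holo op by (auto simp: interior_open \<Omega>_def intro!: holomorphic_intros)
      show "continuous_on (closure \<Omega>) (\<lambda>z. h z ^ n * g z)"
        by (intro continuous_intros continuous_on_subset[OF cont(1) sub] continuous_on_subset[OF cont(2) sub])
      show "bounded \<Omega>" by (rule bounded_subset[of "ball 0 1"]) (auto simp: \<Omega>_def)
      show "a \<in> \<Omega>" using a by (simp add: \<Omega>_def)
      fix z assume z: "z \<in> frontier \<Omega>"
      then have zc: "z \<in> cball 0 1" "z \<notin> \<Omega>"
        using sub op by (auto simp: frontier_def interior_open)
      show "cmod (h z ^ n * g z) \<le> M ^ n * C"
      proof (cases "cmod z = 1")
        case True
        then show ?thesis using M[OF True] C[OF zc(1)] C0 M0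
          by (auto simp: norm_mult norm_power intro!: mult_mono power_mono)
      next
        case False
        then have "g z = 0" using zc by (auto simp: \<Omega>_def)
        then show ?thesis using C0 M0 by simp
      qed
    qed
    then show ?thesis by (simp add: norm_mult norm_power)
  qed
  have ga: "cmod (g a) > 0" using a by simp
  show False
  proof (cases "M = 0")
    case True
    then show False using bound[of 1] ga less by (simp add: mult_le_0_iff)
  next
    case False
    then have Mp: "M > 0" using M0 by simp
    have "1 < cmod (h a) / M" using less Mp by simp
    then obtain n where "C / cmod (g a) < (cmod (h a) / M) ^ n"
      using real_arch_pow by blast
    then show False using bound[of n] ga Mp by (simp add: field_simps power_divide)
  qed
qed

text \<open>The moduli of \<open>exp h\<close> and \<open>exp (- h)\<close> are the exponentials of
  \<open>Re h\<close> and \<open>- Re h\<close>, so the modulus bound for both controls the real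
  part from two sides.\<close>

lemma max_Re_off_zeros:
  fixes g h :: "complex \<Rightarrow> complex"
  assumes cont: "continuous_on (cball 0 1) g" "continuous_on (cball 0 1) h"
    and holo: "g holomorphic_on {z\<in>ball 0 1. g z \<noteq> 0}" "h holomorphic_on {z\<in>ball 0 1. g z \<noteq> 0}"
    and e: "\<And>z. cmod z = 1 \<Longrightarrow> \<bar>Re (h z)\<bar> \<le> e"
    and a: "a \<in> ball 0 1" "g a \<noteq> 0"
  shows "\<bar>Re (h a)\<bar> \<le> e"
proof -
  have "cmod (exp (h a)) \<le> exp e"
  proof (rule max_modulus_off_zeros[OF cont(1) _ holo(1) _ _ a])
    show "cmod (exp (h z)) \<le> exp e" if "cmod z = 1" for z
      using e[OF that] by simp
  qed (intro continuous_intros holomorphic_intros cont holo)+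
  moreover have "cmod (exp (- h a)) \<le> exp e"
  proof (rule max_modulus_off_zeros[OF cont(1) _ holo(1) _ _ a])
    show "cmod (exp (- h z)) \<le> exp e" if "cmod z = 1" for z
      using e[OF that] by simp
  qed (intro continuous_intros holomorphic_intros cont holo)+
  ultimately show ?thesis by auto
qed

section \<open>Boundary values on the unit circle\<close>

text \<open>Real parts of complex polynomials; their restrictions to the unit circle are the real
  trigonometric polynomials. Each is the real part of an entire function, whereas products stay in
  the class only on the circle.\<close>

inductive trig_poly :: "(complex \<Rightarrow> real) \<Rightarrow> bool" where
  monom: "trig_poly (\<lambda>z. Re (c * z ^ k))"
| add: "trig_poly u \<Longrightarrow> trig_poly v \<Longrightarrow> trig_poly (\<lambda>z. u z + v z)"

lemma trig_poly_imp_Re_entire: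
  "trig_poly u \<Longrightarrow> \<exists>p. p holomorphic_on UNIV \<and> u = (\<lambda>z. Re (p z))"
proof (induction rule: trig_poly.induct)
  case (monom c k)
  then show ?case by (intro exI[of _ "\<lambda>z. c * z ^ k"]) (auto intro!: holomorphic_intros)
next
  case (add u v)
  then obtain p q where "p holomorphic_on UNIV" "u = (\<lambda>z. Re (p z))"
      "q holomorphic_on UNIV" "v = (\<lambda>z. Re (q z))" by blast
  then show ?case by (intro exI[of _ "\<lambda>z. p z + q z"]) (auto intro!: holomorphic_intros)
qed

text \<open>\<open>Re a * Re b\<close> is half the real part of \<open>a * b + a * cnj b\<close>. On
  the circle conjugation inverts \<open>z\<close>, so the mixed term has exponent
  \<open>i - j\<close>, and \<open>j \<le> i\<close> keeps it a natural number.\<close>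

lemma trig_poly_monom_mult:
  assumes "j \<le> i"
  shows "\<exists>w. trig_poly w \<and> (\<forall>z. cmod z = 1 \<longrightarrow> w z = Re (c * z ^ i) * Re (d * z ^ j))"
proof -
  define w where "w = (\<lambda>z. Re ((c * d / 2) * z ^ (i + j)) + Re ((c * cnj d / 2) * z ^ (i - j)))"
  have "w z = Re (c * z ^ i) * Re (d * z ^ j)" if "cmod z = 1" for z
  proof -
    have "z ^ i * cnj (z ^ j) = z ^ (i - j) * (z * cnj z) ^ j"
      using assms by (simp add: power_mult_distrib flip: power_add mult.assoc)
    also have "z * cnj z = 1" using that by (simp add: complex_norm_square[symmetric])
    finally have *: "z ^ (i - j) = z ^ i * cnj (z ^ j)" by simp
    have "w z = Re ((c * z ^ i) * (d * z ^ j) + (c * z ^ i) * cnj (d * z ^ j)) / 2"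
      unfolding w_def * by (simp add: power_add algebra_simps add_divide_distrib diff_divide_distrib)
    also have "\<dots> = Re (c * z ^ i) * Re (d * z ^ j)"
      by (simp only: times_complex.simps plus_complex.simps cnj.simps) algebra
    finally show ?thesis .
  qed
  moreover have "trig_poly w"
    unfolding w_def by (intro trig_poly.add trig_poly.monom)
  ultimately show ?thesis by blast
qed

lemma trig_poly_mult:
  assumes "trig_poly u" "trig_poly v"
  shows "\<exists>w. trig_poly w \<and> (\<forall>z. cmod z = 1 \<longrightarrow> w z = u z * v z)"
  using assms(1)
proof (induction rule: trig_poly.induct)
  case (monom c i)
  show ?case using assms(2)
  proof (induction rule: trig_poly.induct)
    case (monom d j)
    show ?case
    proof (cases "j \<le> i")
      case True
      then show ?thesis by (rule trig_poly_monom_mult)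
    next
      case False
      then have "i \<le> j" by simp
      from trig_poly_monom_mult[OF this, of d c] show ?thesis by (simp only: mult.commute)
    qed
  next
    case (add u v)
    then show ?case by (metis (no_types, lifting) distrib_left trig_poly.add)
  qed
next
  case (add u1 u2)
  then show ?case by (metis (no_types, lifting) distrib_right trig_poly.add)
qed

text \<open>Stone-Weierstrass supplies polynomials in the two real coordinates. The linear ones are
  real parts, since a real-linear \<open>f\<close> is \<open>Re (a * z)\<close> with
  \<open>a = f 1 - \<i> * f \<i>\<close>; the rest is closure under sums and products.\<close>

lemma real_polynomial_function_trig_poly:
  assumes "real_polynomial_function u"
  shows "\<exists>w. trig_poly w \<and> (\<forall>z. cmod z = 1 \<longrightarrow> w z = u z)"
  using assms
proof (induction rule: real_polynomial_function.induct)
  case (linear f)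
  interpret bounded_linear f by fact
  have eq: "f z = Re ((f 1 - \<i> * f \<i>) * z ^ 1)" for z
  proof -
    have "z = Re z *\<^sub>R 1 + Im z *\<^sub>R \<i>" by (simp add: complex_eq_iff)
    then have "f z = Re z * f 1 + Im z * f \<i>" by (metis add scale real_scaleR_def)
    then show ?thesis by simp
  qed
  show ?case
    by (intro exI[of _ "\<lambda>z. Re ((f 1 - \<i> * f \<i>) * z ^ 1)"] conjI trig_poly.monom allI impI eq[symmetric])
next
  case (const c)
  then show ?case
    using trig_poly.monom[of "of_real c" 0] by (intro exI[of _ "\<lambda>z. Re (of_real c * z ^ 0)"]) simp
next
  case (add f g)
  then show ?case by (metis (no_types, lifting) trig_poly.add)
next
  case (mult f g)
  then show ?case by (metis (no_types, lifting) trig_poly_mult)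
qed

text \<open>Takes the place of the Dirichlet problem on the disc: the boundary values are only
  approximated, but by harmonic functions with a holomorphic partner known from the start.\<close>

lemma Re_entire_approx_circle:
  assumes "continuous_on (sphere (0::complex) 1) u" "0 < (e::real)"
  shows "\<exists>p. p holomorphic_on UNIV \<and> (\<forall>z. cmod z = 1 \<longrightarrow> \<bar>u z - Re (p z)\<bar> < e)"
proof -
  obtain q where q: "real_polynomial_function q" "\<And>z. z \<in> sphere 0 1 \<Longrightarrow> \<bar>u z - q z\<bar> < e"
    using Stone_Weierstrass_real_polynomial_function[OF compact_sphere assms] by blast
  obtain w where "trig_poly w" "\<And>z. cmod z = 1 \<Longrightarrow> w z = q z"
    using real_polynomial_function_trig_poly[OF q(1)] by blast
  moreover obtain p where "p holomorphic_on UNIV" "w = (\<lambda>z. Re (p z))"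
    using trig_poly_imp_Re_entire[OF calculation(1)] by blast
  ultimately show ?thesis using q(2) by (intro exI[of _ p]) auto
qed

text \<open>A form of the Borel--Caratheodory inequality, by the Schwarz lemma for \<open>q / (2 A - q)\<close>.\<close>

lemma norm_le_of_Re_le:
  assumes holo: "q holomorphic_on ball 0 1" and q0: "q 0 = 0"
    and Re: "\<And>z. z \<in> ball 0 1 \<Longrightarrow> Re (q z) < A" and A: "0 < A" and w: "w \<in> ball 0 1"
  shows "cmod (q w) \<le> 2 * A * cmod w / (1 - cmod w)"
proof -
  define f where "f = (\<lambda>z. q z / (2 * of_real A - q z))"
  have ne: "2 * of_real A - q z \<noteq> 0" if "z \<in> ball 0 1" for z
  proof
    assume "2 * of_real A - q z = 0"
    then have "Re (q z) = 2 * A" by (metis Re_complex_of_real eq_iff_diff_eq_0 of_real_mult of_real_numeral)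
    then show False using Re[OF that] A by simp
  qed
  have lt: "cmod (f z) < 1" if "cmod z < 1" for z
  proof -
    have z: "z \<in> ball 0 1" using that by simp
    have "(cmod (q z))\<^sup>2 < (cmod (2 * of_real A - q z))\<^sup>2"
    proof -
      have "(cmod (2 * of_real A - q z))\<^sup>2 - (cmod (q z))\<^sup>2 = 4 * A * (A - Re (q z))"
        unfolding cmod_power2 by (simp add: power2_eq_square algebra_simps)
      moreover have "4 * A * (A - Re (q z)) > 0" using Re[OF z] A by simp
      ultimately show ?thesis by linarith
    qed
    then have "cmod (q z) < cmod (2 * of_real A - q z)"
      by (rule power2_less_imp_less) simp
    then show ?thesis using ne[OF z] by (simp add: f_def norm_divide)
  qed
  have "cmod (f w) \<le> cmod w"
    using holo ne lt w
    by (intro Schwarz_Lemma(1)) (auto simp: f_def q0 intro!: holomorphic_intros)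
  then have "cmod (q w) \<le> cmod w * cmod (2 * of_real A - q w)"
    using ne[OF w] by (simp add: f_def norm_divide divide_le_eq)
  also have "\<dots> \<le> cmod w * (2 * A + cmod (q w))"
    using A norm_triangle_ineq4[of "2 * of_real A" "q w"] by (intro mult_left_mono) auto
  finally have "cmod (q w) * (1 - cmod w) \<le> 2 * A * cmod w" by (simp add: algebra_simps)
  then show ?thesis using w by (simp add: le_divide_eq)
qed

section \<open>Holomorphic extension across the zero set\<close>

text \<open>On the circle \<open>Re h\<close> is a uniform limit of functions
  \<open>Re (p n)\<close>. The maximum principle off the zeros carries the convergence to every
  point with \<open>g z \<noteq> 0\<close>, and normality of the suitably shifted \<open>p n\<close>
  yields a limit that is holomorphic on the whole disc.\<close>

lemma Re_eq_Re_holomorphic: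
  fixes g h :: "complex \<Rightarrow> complex"
  assumes cont: "continuous_on (cball 0 1) g" "continuous_on (cball 0 1) h"
    and holo: "g holomorphic_on {z\<in>ball 0 1. g z \<noteq> 0}" "h holomorphic_on {z\<in>ball 0 1. g z \<noteq> 0}"
  obtains P where "P holomorphic_on ball 0 1"
    "\<And>z. z \<in> ball 0 1 \<Longrightarrow> g z \<noteq> 0 \<Longrightarrow> Re (h z) = Re (P z)"
proof -
  have "\<exists>p. p holomorphic_on UNIV \<and> (\<forall>z. cmod z = 1 \<longrightarrow> \<bar>Re (h z) - Re (p z)\<bar> < inverse (Suc n))" for n
    by (rule Re_entire_approx_circle)
       (auto intro!: continuous_intros continuous_on_subset[OF cont(2)])
  then obtain p where p: "\<And>n. p n holomorphic_on UNIV"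
    "\<And>n z. cmod z = 1 \<Longrightarrow> \<bar>Re (h z) - Re (p n z)\<bar> < inverse (Suc n)"
    by metis
  have p_holo: "p n holomorphic_on S" for n S
    using p(1) holomorphic_on_subset by blast
  have p_cont: "continuous_on S (p n)" for n S
    using p_holo holomorphic_on_imp_continuous_on by blast
  have conv: "\<bar>Re (h a) - Re (p n a)\<bar> \<le> inverse (Suc n)" if "a \<in> ball 0 1" "g a \<noteq> 0" for a n
  proof -
    have "\<bar>Re (h a - p n a)\<bar> \<le> inverse (Suc n)"
    proof (rule max_Re_off_zeros[OF cont(1) _ holo(1) _ _ that])
      show "continuous_on (cball 0 1) (\<lambda>z. h z - p n z)"
        by (intro continuous_intros cont p_cont)
      show "(\<lambda>z. h z - p n z) holomorphic_on {z\<in>ball 0 1. g z \<noteq> 0}"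
        by (intro holomorphic_intros holo p_holo)
      show "\<bar>Re (h z - p n z)\<bar> \<le> inverse (Suc n)" if "cmod z = 1" for z
        using p(2)[OF that, of n] by simp
    qed
    then show ?thesis by simp
  qed
  obtain C where C: "\<And>z. z \<in> cball 0 1 \<Longrightarrow> cmod (h z) \<le> C"
    using compact_continuous_image[OF cont(2) compact_cball, THEN compact_imp_bounded]
    unfolding bounded_iff by blast
  have C0: "0 \<le> C" using C[of 0] by (auto intro: order_trans[OF norm_ge_zero])
  \<comment> \<open>With the constant 1 in place of \<open>g\<close> there are no zeros, so the
    bound holds throughout the disc.\<close>
  have Re_p: "\<bar>Re (p n z)\<bar> \<le> C + 1" if "z \<in> ball 0 1" for z n
  proof (rule max_Re_off_zeros[of "\<lambda>_. 1" "p n"])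
    fix z assume z: "cmod z = 1"
    have "\<bar>Re (h z)\<bar> \<le> C" using C[of z] z abs_Re_le_cmod[of "h z"] by auto
    moreover have "inverse (real (Suc n)) \<le> 1" by (simp add: field_simps)
    ultimately show "\<bar>Re (p n z)\<bar> \<le> C + 1" using p(2)[OF z, of n] by linarith
  qed (use that p_holo p_cont in auto)
  \<comment> \<open>The approximation says nothing about imaginary constants, which could run off to
    infinity. Removing the one at the centre leaves the real parts alone and makes Montel's theorem
    applicable.\<close>
  define q where "q = (\<lambda>n z. p n z - \<i> * Im (p n 0))"
  have q_holo: "q n holomorphic_on ball 0 1" for n
    unfolding q_def by (intro holomorphic_intros p_holo)
  have q_bound: "cmod (q n z) \<le> (C + 1) + 2 * (2 * C + 3) * r / (1 - r)"
    if z: "cmod z \<le> r" "r < 1" for n z r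
  proof -
    have zb: "z \<in> ball 0 1" using z by simp
    \<comment> \<open>Two real parts of modulus at most \<open>C + 1\<close> differ by at most
      \<open>2 * C + 2\<close>; the additional 1 gives the strict inequality required by
      \<open>norm_le_of_Re_le\<close>.\<close>
    have re: "Re (q n z - q n 0) < 2 * C + 3" if "z \<in> ball 0 1" for z
      using Re_p[OF that, of n] Re_p[of 0 n] by (simp add: q_def)
    have "cmod (q n z - q n 0) \<le> 2 * (2 * C + 3) * cmod z / (1 - cmod z)"
      by (rule norm_le_of_Re_le[of "\<lambda>z. q n z - q n 0"])
         (use C0 zb re in \<open>auto intro!: holomorphic_intros q_holo\<close>)
    also have "\<dots> \<le> 2 * (2 * C + 3) * r / (1 - r)"
      using z C0 order_trans[OF norm_ge_zero z(1)] by (intro frac_le mult_left_mono mult_nonneg_nonneg) auto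
    finally have 1: "cmod (q n z - q n 0) \<le> \<dots>" .
    have "q n 0 = of_real (Re (p n 0))" by (simp add: q_def complex_eq_iff)
    then have "cmod (q n 0) \<le> C + 1" using Re_p[of 0 n] by simp
    then show ?thesis using 1 norm_triangle_ineq[of "q n z - q n 0" "q n 0"] by simp
  qed
  obtain P r where P: "P holomorphic_on ball 0 1" "strict_mono (r :: nat \<Rightarrow> nat)"
    "\<And>x. x \<in> ball 0 1 \<Longrightarrow> ((\<lambda>n. q (r n) x) \<longlongrightarrow> P x) sequentially"
  proof (rule Montel[of "ball 0 1" "range q" q])
    fix K assume K: "compact K" "K \<subseteq> ball (0::complex) 1"
    show "\<exists>B. \<forall>h\<in>range q. \<forall>z\<in>K. cmod (h z) \<le> B"
    proof (cases "K = {}")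
      case False
      then obtain x where x: "x \<in> K" "\<And>z. z \<in> K \<Longrightarrow> cmod z \<le> cmod x"
        using continuous_attains_sup[OF K(1) _ continuous_on_norm_id] by auto
      then show ?thesis using q_bound[of _ "cmod x"] K(2) by (fastforce simp: subset_iff)
    qed auto
  qed (use q_holo in auto)
  show thesis
  proof (rule that[OF P(1)])
    fix z assume z: "z \<in> ball 0 1" "g z \<noteq> 0"
    have "(\<lambda>n. Re (q n z)) \<longlonglongrightarrow> Re (h z)"
    proof (rule LIM_zero_cancel, rule tendsto_0_le[where K=1])
      show "(\<lambda>n. inverse (real (Suc n))) \<longlonglongrightarrow> 0" by (rule LIMSEQ_inverse_real_of_nat)
      show "\<forall>\<^sub>F n in sequentially. norm (Re (q n z) - Re (h z)) \<le> norm (inverse (real (Suc n))) * 1"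
        using conv[OF z] by (auto simp: q_def abs_minus_commute)
    qed
    then have "(\<lambda>n. Re (q (r n) z)) \<longlonglongrightarrow> Re (h z)"
      using LIMSEQ_subseq_LIMSEQ[OF _ P(2)] by (fastforce simp: o_def)
    moreover have "(\<lambda>n. Re (q (r n) z)) \<longlonglongrightarrow> Re (P z)"
      using P(3)[OF z(1)] by (intro tendsto_intros)
    ultimately show "Re (h z) = Re (P z)" by (rule LIMSEQ_unique)
  qed
qed

text \<open>The derivative of \<open>Re k\<close> is the map sending \<open>x\<close> to
  \<open>Re (d * x)\<close> with \<open>d = deriv k z\<close>, and its value at \<open>cnj d\<close>
  is the squared modulus of \<open>d\<close>.\<close>

lemma deriv_eq_0_if_Re_eq_0:
  assumes "k holomorphic_on S" "open S" "\<And>z. z \<in> S \<Longrightarrow> Re (k z) = 0" "z \<in> S"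
  shows "deriv k z = 0"
proof -
  have "(k has_derivative (\<lambda>x. deriv k z * x)) (at z)"
    using holomorphic_derivI[OF assms(1,2,4)] by (simp add: has_field_derivative_def)
  then have "((\<lambda>z. Re (k z)) has_derivative (\<lambda>x. Re (deriv k z * x))) (at z)"
    by (rule bounded_linear.has_derivative[OF bounded_linear_Re])
  moreover have "((\<lambda>z. Re (k z)) has_derivative (\<lambda>x. 0)) (at z)"
    by (rule has_derivative_transform_within_open[of "\<lambda>_. 0" _ _ _ S]) (use assms in auto)
  ultimately have "(\<lambda>x. Re (deriv k z * x)) = (\<lambda>x. 0)" by (rule has_derivative_unique)
  from fun_cong[OF this, of "cnj (deriv k z)"] show ?thesis
    by (simp add: complex_eq_iff sum_squares_eq_zero_iff)
qed

text \<open>On each component of \<Omega> the functions \<open>h\<close> and \<open>P\<close> differ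
  by an imaginary constant, which might change from one component to the next. The extension
  \<open>Q\<close> of \<open>Im h\<close> excludes this: \<open>P - \<i> * Q\<close> has derivative
  0 on \<Omega>, hence is constant on a ball and then on the connected disc, so that
  \<open>Im h\<close> is \<open>Im P\<close> minus one and the same constant everywhere.\<close>

lemma holomorphic_extension_off_zeros:
  fixes g h :: "complex \<Rightarrow> complex"
  assumes cont: "continuous_on (cball 0 1) g" "continuous_on (cball 0 1) h"
    and holo: "g holomorphic_on {z\<in>ball 0 1. g z \<noteq> 0}" "h holomorphic_on {z\<in>ball 0 1. g z \<noteq> 0}"
    and b: "b \<in> ball 0 1" "g b \<noteq> 0"
  obtains H where "H holomorphic_on ball 0 1"
    "\<And>z. z \<in> ball 0 1 \<Longrightarrow> g z \<noteq> 0 \<Longrightarrow> h z = H z"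
proof -
  define \<Omega> where "\<Omega> = {z\<in>ball 0 1. g z \<noteq> 0}"
  have op: "open \<Omega>"
    unfolding \<Omega>_def using continuous_on_subset[OF cont(1)] by (intro open_nonzero_set) auto
  obtain P where P: "P holomorphic_on ball 0 1"
    "\<And>z. z \<in> ball 0 1 \<Longrightarrow> g z \<noteq> 0 \<Longrightarrow> Re (h z) = Re (P z)"
    by (rule Re_eq_Re_holomorphic[OF cont holo]) simp
  have i_h: "continuous_on (cball 0 1) (\<lambda>z. - \<i> * h z)" "(\<lambda>z. - \<i> * h z) holomorphic_on {z\<in>ball 0 1. g z \<noteq> 0}"
    by (intro continuous_intros holomorphic_intros cont holo)+
  obtain Q where Q: "Q holomorphic_on ball 0 1"
    "\<And>z. z \<in> ball 0 1 \<Longrightarrow> g z \<noteq> 0 \<Longrightarrow> Re (- \<i> * h z) = Re (Q z)"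
    by (rule Re_eq_Re_holomorphic[OF cont(1) i_h(1) holo(1) i_h(2)]) simp
  have "\<Omega> \<subseteq> ball 0 1" by (auto simp: \<Omega>_def)
  then have holo': "P holomorphic_on \<Omega>" "Q holomorphic_on \<Omega>" "h holomorphic_on \<Omega>"
    using P(1) Q(1) holo(2) holomorphic_on_subset unfolding \<Omega>_def by blast+
  define k where "k = (\<lambda>z. P z - \<i> * Q z)"
  have k: "k holomorphic_on ball 0 1" unfolding k_def by (intro holomorphic_intros P Q)
  have "deriv k z = 0" if z: "z \<in> \<Omega>" for z
  proof -
    have "deriv (\<lambda>z. P z - h z) z = 0"
    proof (rule deriv_eq_0_if_Re_eq_0[OF _ op _ z])
      show "Re (P x - h x) = 0" if "x \<in> \<Omega>" for x
        using that P(2) by (simp add: \<Omega>_def)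
    qed (intro holomorphic_intros holo')
    moreover have "deriv (\<lambda>z. Q z + \<i> * h z) z = 0"
    proof (rule deriv_eq_0_if_Re_eq_0[OF _ op _ z])
      show "Re (Q x + \<i> * h x) = 0" if "x \<in> \<Omega>" for x
        using that Q(2)[of x] by (simp add: \<Omega>_def)
    qed (intro holomorphic_intros holo')
    moreover have d: "(P has_field_derivative deriv P z) (at z)" "(Q has_field_derivative deriv Q z) (at z)"
      "(h has_field_derivative deriv h z) (at z)"
      using holo' z op holomorphic_derivI by blast+
    moreover have "deriv (\<lambda>z. P z - h z) z = deriv P z - deriv h z"
      by (intro DERIV_imp_deriv derivative_intros d)
    moreover have "deriv (\<lambda>z. Q z + \<i> * h z) z = deriv Q z + \<i> * deriv h z"
      by (intro DERIV_imp_deriv derivative_intros DERIV_cmult d)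
    moreover have "deriv k z = deriv P z - \<i> * deriv Q z"
      unfolding k_def by (intro DERIV_imp_deriv derivative_intros DERIV_cmult d)
    ultimately have "deriv P z = deriv h z" "deriv Q z = - \<i> * deriv h z" "deriv k z = deriv P z - \<i> * deriv Q z"
      by (simp_all add: eq_neg_iff_add_eq_0)
    then show ?thesis by simp
  qed
  moreover obtain e where e: "0 < e" "ball b e \<subseteq> \<Omega>"
    using op b by (auto simp: \<Omega>_def open_contains_ball)
  ultimately have "\<And>z. z \<in> ball b e \<Longrightarrow> (k has_field_derivative 0) (at z)"
    using holomorphic_derivI[OF holomorphic_on_subset[OF k \<open>\<Omega> \<subseteq> _\<close>] op] by (metis subsetD)
  then obtain c where "\<And>z. z \<in> ball b e \<Longrightarrow> k z = c"
    using has_field_derivative_zero_constant[OF convex_ball] has_field_derivative_at_within by metis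
  then have kc: "k z = k b" if "z \<in> ball b e" for z
    using that e(1) by (metis centre_in_ball)
  have k_const: "k z = k b" if "z \<in> ball 0 1" for z
  proof (rule analytic_continuation_open[of "ball b e" "ball 0 1" k "\<lambda>_. k b"])
    show "ball b e \<subseteq> ball 0 1" using e(2) \<open>\<Omega> \<subseteq> _\<close> by (rule order_trans)
    show "ball b e \<noteq> {}" using e(1) by simp
  qed (use that k kc in \<open>simp_all only: open_ball connected_ball holomorphic_on_const\<close>)
  show thesis
  proof (rule that[of "\<lambda>z. P z - \<i> * Im (k b)"])
    show "(\<lambda>z. P z - \<i> * Im (k b)) holomorphic_on ball 0 1"
      by (intro holomorphic_intros P)
    show "h z = P z - \<i> * Im (k b)" if "z \<in> ball 0 1" "g z \<noteq> 0" for z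
    proof -
      show ?thesis using P(2)[OF that] Q(2)[OF that] k_const[OF that(1)]
        unfolding complex_eq_iff k_def by simp
    qed
  qed
qed

lemma fsigma_ball: "fsigma (ball (a::'a::euclidean_space) r)"
proof -
  obtain C :: "nat \<Rightarrow> 'a set" where "\<And>n. compact (C n)" "\<Union>(range C) = ball a r"
    using open_Union_compact_subsets[OF open_ball] by metis
  then show ?thesis unfolding fsigma_Union_compact by (intro exI[of _ C]) auto
qed

text \<open>The classical case is \<open>h = g\<close>; here \<open>g\<close> only marks the
  exceptional set. Its extension \<open>G\<close> is not identically 0, so it has countably many
  zeros and their complement \<open>N\<close> in the disc is connected. In \<open>N\<close> the set
  \<Omega> is open and closed, so it contains \<open>N\<close> and is dense, and the continuous
  \<open>h\<close> agrees with its extension \<open>H\<close>.\<close>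

theorem rado:
  fixes g h :: "complex \<Rightarrow> complex"
  assumes cont: "continuous_on (cball 0 1) g" "continuous_on (cball 0 1) h"
    and holo: "g holomorphic_on {z\<in>ball 0 1. g z \<noteq> 0}" "h holomorphic_on {z\<in>ball 0 1. g z \<noteq> 0}"
    and b: "b \<in> ball 0 1" "g b \<noteq> 0"
  shows "h holomorphic_on ball 0 1"
proof -
  define \<Omega> where "\<Omega> = {z\<in>ball 0 1. g z \<noteq> 0}"
  have cont': "continuous_on (ball 0 1) g" "continuous_on (ball 0 1) h"
    using cont continuous_on_subset ball_subset_cball by blast+
  have op: "open \<Omega>"
    unfolding \<Omega>_def using cont' by (intro open_nonzero_set) auto
  obtain G where G: "G holomorphic_on ball 0 1" "\<And>z. z \<in> \<Omega> \<Longrightarrow> g z = G z"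
    by (rule holomorphic_extension_off_zeros[OF cont(1,1) holo(1,1) b]) (simp add: \<Omega>_def)
  obtain H where H: "H holomorphic_on ball 0 1" "\<And>z. z \<in> \<Omega> \<Longrightarrow> h z = H z"
    by (rule holomorphic_extension_off_zeros[OF cont holo b]) (simp add: \<Omega>_def)
  have contG: "continuous_on (ball 0 1) G" and contH: "continuous_on (ball 0 1) H"
    using G(1) H(1) holomorphic_on_imp_continuous_on by blast+
  have limit: "u z = v z" if "continuous_on (ball 0 1) u" "continuous_on (ball 0 1) v"
    "\<And>z. z \<in> \<Omega> \<Longrightarrow> u z = v z" "z \<in> closure \<Omega>" "z \<in> ball 0 1" for u v :: "complex \<Rightarrow> complex" and z
  proof -
    have "closedin (top_of_set (ball 0 1)) {z\<in>ball 0 1. u z - v z = 0}"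
      by (intro continuous_closedin_preimage_constant continuous_intros that)
    then obtain T where T: "closed T" "{z\<in>ball 0 1. u z - v z = 0} = ball 0 1 \<inter> T"
      by (auto simp: closedin_closed)
    have "\<Omega> \<subseteq> {z\<in>ball 0 1. u z - v z = 0}" using that(3) by (auto simp: \<Omega>_def)
    then have "\<Omega> \<subseteq> T" using T(2) by blast
    then have "z \<in> T" using that(4) T(1) closure_minimal by blast
    then have "z \<in> {z\<in>ball 0 1. u z - v z = 0}" unfolding T(2) using that(5) by simp
    then show ?thesis by simp
  qed
  \<comment> \<open>A point of the disc that is in the closure of \<Omega> but not in \<Omega> has
    \<open>g z = 0\<close>, hence \<open>G z = 0\<close>. So \<Omega> is relatively closed off the
    zeros of \<open>G\<close>.\<close>
  have bound: "z \<in> \<Omega>" if "z \<in> closure \<Omega>" "z \<in> ball 0 1" "G z \<noteq> 0" for z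
  proof -
    have "g z = G z" by (rule limit[OF cont'(1) contG G(2) that(1,2)])
    then show ?thesis using that(2,3) by (simp add: \<Omega>_def)
  qed
  have nc: "countable {z\<in>ball 0 1. G z = 0}"
  proof (cases "G constant_on ball 0 1")
    case True
    then obtain c where c: "\<And>z. z \<in> ball 0 1 \<Longrightarrow> G z = c" unfolding constant_on_def by blast
    have "c \<noteq> 0" using c[of b] G(2)[of b] b by (simp add: \<Omega>_def)
    then have "{z\<in>ball 0 1. G z = 0} = {}" using c by simp
    then show ?thesis by (simp only: countable_empty)
  next
    case False
    then show ?thesis
      by (intro holomorphic_countable_zeros[OF G(1) _ _ fsigma_ball]) auto
  qed
  define N where "N = ball 0 1 - {z\<in>ball 0 1. G z = 0}"
  have conn: "connected N"
    unfolding N_def by (rule connected_open_diff_countable) (use nc in auto)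
  have "N \<subseteq> \<Omega>"
  proof (rule ccontr)
    assume "\<not> N \<subseteq> \<Omega>"
    then obtain x where "x \<in> N" "x \<notin> \<Omega>" by blast
    then have "x \<in> - closure \<Omega> \<inter> N" using bound[of x] by (auto simp: N_def)
    then have "- closure \<Omega> \<inter> N \<noteq> {}" by blast
    moreover have "\<Omega> \<inter> N \<noteq> {}" using b G(2)[of b] by (auto simp: \<Omega>_def N_def)
    moreover have "N \<subseteq> \<Omega> \<union> - closure \<Omega>" using bound unfolding N_def by blast
    moreover have "\<Omega> \<inter> - closure \<Omega> \<inter> N = {}" using closure_subset by blast
    ultimately show False
      using connectedD[OF conn op, of "- closure \<Omega>"] by auto
  qed
  have dense: "z \<in> closure \<Omega>" if "z \<in> ball 0 1" for z
  proof (rule ccontr)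
    assume "z \<notin> closure \<Omega>"
    then have "z \<in> ball 0 1 - closure \<Omega>" "open (ball 0 1 - closure \<Omega>)" using that by auto
    then obtain e where e: "e > 0" "ball z e \<subseteq> ball 0 1 - closure \<Omega>"
      unfolding open_contains_ball by blast
    have "ball 0 1 - closure \<Omega> \<subseteq> {z\<in>ball 0 1. G z = 0}"
      using \<open>N \<subseteq> \<Omega>\<close> closure_subset by (fastforce simp: N_def)
    then have "countable (ball 0 1 - closure \<Omega>)" using nc countable_subset by blast
    with e show False using uncountable_ball[OF e(1)] countable_subset[OF e(2)] by blast
  qed
  have "h z = H z" if "z \<in> ball 0 1" for z
    by (rule limit[OF cont'(2) contH H(2) dense[OF that] that])
  then show ?thesis using holomorphic_transform[OF H(1)] by metis
qed

section \<open>Holomorphy in several variables\<close>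

lemma norm_vector_scalar_mult: "norm (c *s v) = cmod c * norm (v :: complex^'n)"
  by (simp add: norm_vec_def L2_set_right_distrib norm_mult)

lemma bounded_linear_vector_scalar_mult_left: "bounded_linear (\<lambda>t. t *s (v :: complex^'n))"
  by (rule bounded_linear_intro[where K = "norm v"])
     (auto simp: norm_vector_scalar_mult vec_eq_iff algebra_simps)

lemmas continuous_on_vector_scalar_mult_left [continuous_intros] =
  bounded_linear.continuous_on[OF bounded_linear_vector_scalar_mult_left]
lemmas tendsto_vector_scalar_mult_left [tendsto_intros] =
  bounded_linear.tendsto[OF bounded_linear_vector_scalar_mult_left]

lemma open_line_preimage:
  fixes z v :: "complex^'n"
  assumes "open S"
  shows "open {t. z + t *s v \<in> S}"
proof -
  have "open ((\<lambda>t. z + t *s v) -` S)"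
    by (rule open_vimage[OF assms]) (intro continuous_intros)
  then show ?thesis by (simp add: vimage_def)
qed

text \<open>Holomorphy along complex lines; by Osgood's lemma, together with continuity this is
  holomorphy, and unlike \<open>holo_on\<close> it is evidently preserved by uniform limits.\<close>

definition line_holo :: "(complex^'n) set \<Rightarrow> (complex^'n \<Rightarrow> complex) \<Rightarrow> bool" where
  "line_holo S f \<longleftrightarrow> continuous_on S f \<and>
     (\<forall>z v. (\<lambda>t. f (z + t *s v)) holomorphic_on {t. z + t *s v \<in> S})"

definition dir_deriv :: "(complex^'n \<Rightarrow> complex) \<Rightarrow> complex^'n \<Rightarrow> complex^'n \<Rightarrow> complex" where
  "dir_deriv f v z = deriv (\<lambda>t. f (z + t *s v)) 0"

lemma line_holo_subset: "line_holo S f \<Longrightarrow> T \<subseteq> S \<Longrightarrow> line_holo T f"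
  unfolding line_holo_def
  by (meson Collect_mono continuous_on_subset holomorphic_on_subset subsetD)

lemma holo_on_imp_line_holo:
  assumes "open S" "holo_on S f"
  shows "line_holo S f"
  unfolding line_holo_def
proof (intro conjI allI)
  show "continuous_on S f"
    using assms(2) has_derivative_continuous unfolding holo_on_def continuous_on_eq_continuous_within by blast
  fix z v
  have "(\<lambda>t. f (z + t *s v)) field_differentiable at t" if t: "z + t *s v \<in> S" for t
  proof -
    obtain D where D: "(f has_derivative D) (at (z + t *s v))" "\<And>c v. D (c *s v) = c * D v"
      using assms t unfolding holo_on_def by (metis at_within_open)
    have "((\<lambda>t. z + t *s v) has_derivative (\<lambda>h. h *s v)) (at t)"
      using bounded_linear_imp_has_derivative[OF bounded_linear_vector_scalar_mult_left]
      by (auto intro!: derivative_eq_intros)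
    from has_derivative_compose[OF this D(1)] show ?thesis
      unfolding D(2) field_differentiable_def has_field_derivative_def by (auto simp: mult.commute[of _ "D v"])
  qed
  then show "(\<lambda>t. f (z + t *s v)) holomorphic_on {t. z + t *s v \<in> S}"
    by (auto simp: holomorphic_on_def intro: field_differentiable_at_within)
qed

lemma line_holo_continuous: "line_holo S f \<Longrightarrow> continuous_on S f"
  by (simp add: line_holo_def)

lemma line_holo_line: "line_holo S f \<Longrightarrow> (\<lambda>t. f (z + t *s v)) holomorphic_on {t. z + t *s v \<in> S}"
  by (simp add: line_holo_def)

lemma line_holo_local:
  assumes "open S" "\<And>z. z \<in> S \<Longrightarrow> \<exists>U. open U \<and> z \<in> U \<and> line_holo U f"
  shows "line_holo S f"
  unfolding line_holo_def
proof (intro conjI allI)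
  show "continuous_on S f"
  proof (rule continuous_at_imp_continuous_on, rule ballI)
    fix z assume "z \<in> S"
    then obtain U where "open U" "z \<in> U" "line_holo U f" using assms(2) by blast
    then show "isCont f z" using line_holo_continuous continuous_on_eq_continuous_at by blast
  qed
  fix z v
  have "(\<lambda>t. f (z + t *s v)) field_differentiable at t" if t: "z + t *s v \<in> S" for t
  proof -
    obtain U where "open U" "z + t *s v \<in> U" "line_holo U f" using assms(2) t by blast
    then show ?thesis
      using line_holo_line[of U f z v] open_line_preimage[of U z v]
      by (intro holomorphic_on_imp_differentiable_at) auto
  qed
  then show "(\<lambda>t. f (z + t *s v)) holomorphic_on {t. z + t *s v \<in> S}"
    by (auto simp: holomorphic_on_def intro: field_differentiable_at_within)
qed

lemma line_holo_const: "line_holo S (\<lambda>z. c)"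
  by (auto simp: line_holo_def)

lemma line_holo_add: "line_holo S f \<Longrightarrow> line_holo S g \<Longrightarrow> line_holo S (\<lambda>z. f z + g z)"
  by (auto simp: line_holo_def intro!: continuous_intros holomorphic_intros)

lemma line_holo_mult: "line_holo S f \<Longrightarrow> line_holo S g \<Longrightarrow> line_holo S (\<lambda>z. f z * g z)"
  by (auto simp: line_holo_def intro!: continuous_intros holomorphic_intros)

lemma line_holo_sum: "(\<And>i. i \<in> I \<Longrightarrow> line_holo S (f i)) \<Longrightarrow> line_holo S (\<lambda>z. \<Sum>i\<in>I. f i z)"
  by (induction I rule: infinite_finite_induct) (auto intro: line_holo_const line_holo_add)

lemma line_holo_prod: "(\<And>i. i \<in> I \<Longrightarrow> line_holo S (f i)) \<Longrightarrow> line_holo S (\<lambda>z. \<Prod>i\<in>I. f i z)"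
  by (induction I rule: infinite_finite_induct) (auto intro: line_holo_const line_holo_mult)

lemma line_holo_divide:
  assumes "line_holo S f" "line_holo S g" "\<And>z. z \<in> S \<Longrightarrow> g z \<noteq> 0"
  shows "line_holo S (\<lambda>z. f z / g z)"
  using assms by (auto simp: line_holo_def intro!: continuous_intros holomorphic_intros)

lemma line_holo_component: "line_holo S (\<lambda>z. z $ i)"
  by (auto simp: line_holo_def intro!: continuous_intros holomorphic_intros)

lemma line_holo_det:
  assumes "\<And>i j. line_holo S (\<lambda>z. M z $ i $ j)"
  shows "line_holo S (\<lambda>z. det (M z))"
  unfolding det_def by (intro line_holo_sum line_holo_mult line_holo_const line_holo_prod assms)

lemma line_holo_shift:
  assumes "line_holo T f" "\<And>z. z \<in> S \<Longrightarrow> z + a \<in> T"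
  shows "line_holo S (\<lambda>z. f (z + a))"
  unfolding line_holo_def
proof (intro conjI allI)
  show "continuous_on S (\<lambda>z. f (z + a))"
    using assms by (intro continuous_on_compose2[OF line_holo_continuous[OF assms(1)]] continuous_intros) auto
  fix z v
  have "(\<lambda>t. f ((z + a) + t *s v)) holomorphic_on {t. z + t *s v \<in> S}"
  proof (rule holomorphic_on_subset[OF line_holo_line[OF assms(1)]], safe)
    fix t assume "z + t *s v \<in> S"
    from assms(2)[OF this] show "z + a + t *s v \<in> T" by (simp add: add_ac)
  qed
  moreover have "(z + a) + t *s v = z + t *s v + a" for t by (simp add: add_ac)
  ultimately show "(\<lambda>t. f (z + t *s v + a)) holomorphic_on {t. z + t *s v \<in> S}"
    by simp
qed

lemma line_holo_uniform_limit:
  assumes q: "\<And>n. line_holo U (q n)" and lim: "uniform_limit U q g sequentially" and U: "open U"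
  shows "line_holo U g"
  unfolding line_holo_def
proof (intro conjI allI)
  show "continuous_on U g"
    using q by (intro uniform_limit_theorem[OF _ lim]) (auto simp: line_holo_def)
  fix z v
  show "(\<lambda>t. g (z + t *s v)) holomorphic_on {t. z + t *s v \<in> U}"
  proof (rule holomorphic_uniform_sequence[where f = "\<lambda>n t. q n (z + t *s v)"])
    show op: "open {t. z + t *s v \<in> U}" by (rule open_line_preimage[OF U])
    show "(\<lambda>t. q n (z + t *s v)) holomorphic_on {t. z + t *s v \<in> U}" for n
      by (rule line_holo_line[OF q])
    fix x assume "x \<in> {t. z + t *s v \<in> U}"
    then obtain d where d: "d > 0" "cball x d \<subseteq> {t. z + t *s v \<in> U}"
      using op open_contains_cball by blast
    then have "uniform_limit (cball x d) (\<lambda>n t. q n (z + t *s v)) (\<lambda>t. g (z + t *s v)) sequentially"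
      using lim unfolding uniform_limit_iff by (fast elim!: eventually_mono)
    then show "\<exists>d>0. cball x d \<subseteq> {t. z + t *s v \<in> U} \<and>
        uniform_limit (cball x d) (\<lambda>n t. q n (z + t *s v)) (\<lambda>t. g (z + t *s v)) sequentially"
      using d by blast
  qed
qed

section \<open>Directional derivatives and Osgood's lemma\<close>

text \<open>For \<open>s\<close> in the closed ball of radius \<open>R / 4\<close> the circle of
  radius \<open>R / 2\<close> about \<open>s\<close> stays inside \<open>ball 0 R\<close>, so
  Cauchy's inequality bounds the second derivative by \<open>2 * M / (R / 2)\<^sup>2\<close>; this
  is the origin of the 8.\<close>

lemma first_order_Taylor_bound:
  assumes g: "g holomorphic_on ball 0 R" and M: "\<And>s. s \<in> ball 0 R \<Longrightarrow> cmod (g s) \<le> M"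
    and t: "cmod t \<le> R / 4" and R: "0 < R"
  shows "cmod (g t - g 0 - t * deriv g 0) \<le> 8 * M * (cmod t)\<^sup>2 / R\<^sup>2"
proof -
  have sub: "cball s (R / 2) \<subseteq> ball 0 R" if "s \<in> cball 0 (R / 4)" for s :: complex
  proof
    fix x assume "x \<in> cball s (R / 2)"
    then have "cmod x \<le> R / 4 + R / 2"
      using that norm_triangle_ineq2[of x s] by (simp add: dist_norm norm_minus_commute)
    then show "x \<in> ball 0 R" using R by simp
  qed
  have bound: "cmod ((deriv ^^ 2) g s) \<le> 8 * M / R\<^sup>2" if s: "s \<in> cball 0 (R / 4)" for s
  proof -
    have "cmod ((deriv ^^ 2) g s) \<le> fact 2 * M / (R / 2) ^ 2"
    proof (rule Cauchy_inequality)
      show "g holomorphic_on ball s (R / 2)"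
        using g sub[OF s] ball_subset_cball by (meson holomorphic_on_subset order_trans)
      show "continuous_on (cball s (R / 2)) g"
        using g sub[OF s] holomorphic_on_imp_continuous_on continuous_on_subset by blast
      show "cmod (g x) \<le> M" if "cmod (s - x) = R / 2" for x
        using M sub[OF s] that by (auto simp: dist_norm subset_iff)
    qed (use R in simp)
    then show ?thesis by (simp add: power_divide)
  qed
  have "cmod ((deriv ^^ 0) g t - (\<Sum>i\<le>1. (deriv ^^ i) g 0 * (t - 0) ^ i / fact i))
      \<le> 8 * M / R\<^sup>2 * cmod (t - 0) ^ Suc 1 / fact 1"
  proof (rule complex_Taylor[of "cball 0 (R / 4)"])
    fix i and x :: complex assume x: "x \<in> cball 0 (R / 4)" and "i \<le> (1::nat)"
    have "x \<in> ball 0 R" using x R by (auto simp: dist_norm)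
    then have "((deriv ^^ i) g has_field_derivative deriv ((deriv ^^ i) g) x) (at x)"
      by (intro holomorphic_derivI[OF holomorphic_higher_deriv[OF g open_ball] open_ball])
    then show "((deriv ^^ i) g has_field_derivative (deriv ^^ Suc i) g x) (at x within cball 0 (R / 4))"
      by (simp add: has_field_derivative_at_within)
  qed (use bound t R in \<open>auto simp: numeral_2_eq_2\<close>)
  then show ?thesis by (simp add: algebra_simps power2_eq_square)
qed

text \<open>The point is uniformity. Independence of \<open>z\<close> makes difference quotients
  converge locally uniformly, and dependence on \<open>v\<close> through its norm alone turns
  directional derivatives into a Frechet derivative.\<close>

lemma dir_deriv_estimate:
  assumes f: "line_holo S f" and sub: "ball z R \<subseteq> S" and M: "\<And>w. w \<in> ball z R \<Longrightarrow> cmod (f w) \<le> M"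
    and R: "0 < R" and t: "cmod t * norm v \<le> R / 4"
  shows "cmod (f (z + t *s v) - f z - t * dir_deriv f v z) \<le> 8 * M * (cmod t * norm v)\<^sup>2 / R\<^sup>2"
proof (cases "v = 0")
  case True
  then show ?thesis by (simp add: dir_deriv_def)
next
  case False
  define r where "r = R / norm v"
  have r: "r > 0" using False R by (simp add: r_def)
  have ball: "z + s *s v \<in> ball z R" if "s \<in> ball 0 r" for s
    using that False by (simp add: dist_norm norm_vector_scalar_mult r_def pos_less_divide_eq)
  have "(\<lambda>s. f (z + s *s v)) holomorphic_on ball 0 r"
    by (rule holomorphic_on_subset[OF line_holo_line[OF f]]) (use ball sub in auto)
  then have "cmod (f (z + t *s v) - f (z + 0 *s v) - t * deriv (\<lambda>s. f (z + s *s v)) 0)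
      \<le> 8 * M * (cmod t)\<^sup>2 / r\<^sup>2"
    by (rule first_order_Taylor_bound) (use M ball r t False in \<open>auto simp: r_def pos_le_divide_eq\<close>)
  then show ?thesis by (simp add: dir_deriv_def r_def power_divide power_mult_distrib)
qed

text \<open>The radius is doubled so that every point of \<open>ball z R\<close> still has a ball of
  radius \<open>R\<close> on which the bound holds.\<close>

lemma line_holo_locally_bounded:
  assumes "line_holo S f" "open S" "z \<in> S"
  obtains R M where "0 < R" "0 \<le> M" "ball z (2 * R) \<subseteq> S" "\<And>w. w \<in> ball z (2 * R) \<Longrightarrow> cmod (f w) \<le> M"
proof -
  obtain e where e: "e > 0" "cball z e \<subseteq> S" using assms open_contains_cball by blast
  have "compact (f ` cball z e)"
    by (intro compact_continuous_image continuous_on_subset[OF line_holo_continuous[OF assms(1)] e(2)] compact_cball)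
  from compact_imp_bounded[OF this] obtain M where M: "\<And>w. w \<in> cball z e \<Longrightarrow> cmod (f w) \<le> M"
    unfolding bounded_iff by blast
  have "0 \<le> M" using M[of z] e by (auto intro: order_trans[OF norm_ge_zero])
  moreover have "ball z (2 * (e / 2)) \<subseteq> cball z e" by auto
  ultimately show ?thesis using e M by (intro that[of "e / 2" M]) (simp, assumption, blast+)
qed

text \<open>Near each point the difference quotients converge uniformly, and a uniform limit
  inherits holomorphy on all lines, not only on those in direction \<open>v\<close>.\<close>

lemma line_holo_dir_deriv:
  assumes f: "line_holo S f" and S: "open S"
  shows "line_holo S (dir_deriv f v)"
proof (rule line_holo_local[OF S])
  fix z0 assume "z0 \<in> S"
  then obtain R M where R: "0 < R" and M0: "0 \<le> M" and sub: "ball z0 (2 * R) \<subseteq> S"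
    and M: "\<And>w. w \<in> ball z0 (2 * R) \<Longrightarrow> cmod (f w) \<le> M"
    using line_holo_locally_bounded[OF f S] by metis
  have sub': "ball z R \<subseteq> ball z0 (2 * R)" if "z \<in> ball z0 R" for z
  proof
    fix x assume "x \<in> ball z R"
    then show "x \<in> ball z0 (2 * R)" using that dist_triangle[of z0 x z] by simp
  qed
  \<comment> \<open>Nonzero steps tending to 0, short enough for \<open>dir_deriv_estimate\<close>
    with radius \<open>R\<close>; the summand 1 covers \<open>v = 0\<close>.\<close>
  define h where "h = (\<lambda>n. complex_of_real (R / (4 * (norm v + 1)) * inverse (Suc n)))"
  have h: "h n \<noteq> 0" "cmod (h n) * norm v \<le> R / 4" for n
  proof -
    have nv: "norm v + 1 > 0" using norm_ge_zero[of v] by linarith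
    show "h n \<noteq> 0" using R nv unfolding h_def of_real_eq_0_iff by simp
    have "cmod (h n) = R / (4 * (norm v + 1)) * inverse (Suc n)"
      unfolding h_def norm_of_real using R nv by (intro abs_of_nonneg mult_nonneg_nonneg) auto
    also have "\<dots> \<le> R / (4 * (norm v + 1)) * 1"
      using R nv by (intro mult_left_mono) (auto simp: field_simps)
    finally have "cmod (h n) * norm v \<le> R / (4 * (norm v + 1)) * 1 * norm v"
      by (rule mult_right_mono) simp
    also have "\<dots> \<le> R / 4" using R nv by (simp add: field_simps)
    finally show "cmod (h n) * norm v \<le> R / 4" .
  qed
  have h0: "h \<longlonglongrightarrow> 0"
  proof -
    have "(\<lambda>n. R / (4 * (norm v + 1)) * inverse (Suc n)) \<longlonglongrightarrow> R / (4 * (norm v + 1)) * 0"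
      by (intro tendsto_mult tendsto_const LIMSEQ_inverse_real_of_nat)
    from tendsto_of_real[OF this] show ?thesis unfolding h_def mult_zero_right of_real_0 .
  qed
  define q where "q = (\<lambda>n z. (f (z + h n *s v) + (-1) * f z) / h n)"
  have "line_holo (ball z0 R) (q n)" for n
    unfolding q_def
  proof (intro line_holo_divide line_holo_add line_holo_mult line_holo_const)
    show "line_holo (ball z0 R) (\<lambda>z. f (z + h n *s v))"
    proof (rule line_holo_shift[OF f])
      fix z assume z: "z \<in> ball z0 R"
      have "z + h n *s v \<in> ball z R"
        using h(2)[of n] R by (simp add: dist_norm norm_vector_scalar_mult)
      then show "z + h n *s v \<in> S" using sub sub'[OF z] by blast
    qed
    show "line_holo (ball z0 R) f"
      by (rule line_holo_subset[OF f]) (use sub R in auto)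
  qed (rule h)
  moreover have "uniform_limit (ball z0 R) q (dir_deriv f v) sequentially"
  proof (rule uniform_limitI)
    fix e :: real assume e: "0 < e"
    define C where "C = 8 * M * (norm v)\<^sup>2 / R\<^sup>2"
    have "(\<lambda>n. C * cmod (h n)) \<longlonglongrightarrow> C * cmod 0"
      by (intro tendsto_intros h0)
    then have "\<forall>\<^sub>F n in sequentially. C * cmod (h n) < e"
      using e by (intro order_tendstoD(2)) auto
    then show "\<forall>\<^sub>F n in sequentially. \<forall>z\<in>ball z0 R. dist (q n z) (dir_deriv f v z) < e"
    proof eventually_elim
      case (elim n)
      show ?case
      proof
        fix z assume z: "z \<in> ball z0 R"
        have "ball z R \<subseteq> S" using sub sub'[OF z] by blast
        then have "cmod (f (z + h n *s v) - f z - h n * dir_deriv f v z) \<le> 8 * M * (cmod (h n) * norm v)\<^sup>2 / R\<^sup>2"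
          by (rule dir_deriv_estimate[OF f _ _ R h(2)]) (use M sub'[OF z] in blast)
        then have "cmod (f (z + h n *s v) - f z - h n * dir_deriv f v z) / cmod (h n) \<le> C * cmod (h n)"
          using h(1)[of n] by (simp add: C_def divide_le_eq power_mult_distrib power2_eq_square mult_ac)
        moreover have "q n z - dir_deriv f v z = (f (z + h n *s v) - f z - h n * dir_deriv f v z) / h n"
          using h(1)[of n] by (simp add: q_def field_simps)
        ultimately show "dist (q n z) (dir_deriv f v z) < e"
          using elim by (simp add: dist_norm norm_divide)
      qed
    qed
  qed
  ultimately have "line_holo (ball z0 R) (dir_deriv f v)"
    by (rule line_holo_uniform_limit) simp
  then show "\<exists>U. open U \<and> z0 \<in> U \<and> line_holo U (dir_deriv f v)"
    using R by (intro exI[of _ "ball z0 R"]) auto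
qed

lemma line_deriv:
  assumes f: "line_holo S f" and S: "open S" "z \<in> S"
  shows "((\<lambda>t. f (z + t *s v)) has_field_derivative dir_deriv f v z) (at 0)"
  unfolding dir_deriv_def
  by (rule holomorphic_derivI[OF line_holo_line[OF f] open_line_preimage[OF S(1)]]) (use S(2) in simp)

lemma dir_deriv_scale:
  assumes f: "line_holo S f" and S: "open S" "z \<in> S"
  shows "dir_deriv f (c *s v) z = c * dir_deriv f v z"
proof -
  have "((\<lambda>t. f (z + (t * c) *s v)) has_field_derivative dir_deriv f v z * c) (at 0)"
    by (rule DERIV_chain2[where g = "\<lambda>t. t * c" and x = 0])
       (use line_deriv[OF assms] in \<open>auto intro!: derivative_eq_intros\<close>)
  from DERIV_imp_deriv[OF this] show ?thesis
    by (simp add: dir_deriv_def vector_smult_assoc mult.commute)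
qed

text \<open>Go from \<open>z\<close> to \<open>z + t *s (v + w)\<close> by way of
  \<open>z + t *s v\<close>. The second leg involves the derivative in direction \<open>w\<close> at
  the moving point, so \<open>F t\<close> is small by the estimate, while continuity of that
  derivative identifies its limit as the defect of additivity.\<close>

lemma dir_deriv_add:
  assumes f: "line_holo S f" and S: "open S" "z \<in> S"
  shows "dir_deriv f (v + w) z = dir_deriv f v z + dir_deriv f w z"
proof -
  obtain R M where R: "0 < R" and M0: "0 \<le> M" and sub: "ball z (2 * R) \<subseteq> S"
    and M: "\<And>w. w \<in> ball z (2 * R) \<Longrightarrow> cmod (f w) \<le> M"
    using line_holo_locally_bounded[OF assms] by metis
  define C where "C = 8 * M / R\<^sup>2"
  have est: "cmod (f (x + t *s u) - f x - t * dir_deriv f u x) \<le> C * (cmod t * norm u)\<^sup>2"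
    if x: "x \<in> ball z R" "cmod t * norm u \<le> R / 4" for x t u
  proof -
    have "ball x R \<subseteq> ball z (2 * R)"
    proof
      fix y assume "y \<in> ball x R"
      then show "y \<in> ball z (2 * R)" using x(1) dist_triangle[of z y x] by simp
    qed
    then show ?thesis
      using dir_deriv_estimate[OF f _ _ R x(2), of x M] sub M unfolding C_def by (simp add: subset_iff)
  qed
  define B where "B = (norm (v + w))\<^sup>2 + (norm v)\<^sup>2 + (norm w)\<^sup>2"
  define F where "F = (\<lambda>t. dir_deriv f (v + w) z - dir_deriv f v z - dir_deriv f w (z + t *s v))"
  have lim0: "((\<lambda>t. cmod t * norm u) \<longlongrightarrow> 0) (at 0)" for u :: "complex^'a"
    by (intro tendsto_eq_intros refl) auto
  have small: "\<forall>\<^sub>F t in at 0. cmod t * norm u < R / 4" for u :: "complex^'a"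
    using order_tendstoD(2)[OF lim0, of "R / 4"] R by simp
  have "(F \<longlongrightarrow> 0) (at 0)"
  proof (rule Lim_null_comparison[where g = "\<lambda>t. C * B * cmod t"])
    show "\<forall>\<^sub>F t in at 0. norm (F t) \<le> C * B * cmod t"
      using small[of "v + w"] small[of v] small[of w] eventually_neq_at_within[of 0 0 UNIV]
    proof eventually_elim
      case (elim t)
      have t0: "t \<noteq> 0" using elim by simp
      have zv: "z + t *s v \<in> ball z R" using elim R by (simp add: dist_norm norm_vector_scalar_mult)
      define a b c where "a = f (z + t *s (v + w)) - f z - t * dir_deriv f (v + w) z"
        and "b = f (z + t *s v) - f z - t * dir_deriv f v z"
        and "c = f ((z + t *s v) + t *s w) - f (z + t *s v) - t * dir_deriv f w (z + t *s v)"
      have bnd: "cmod a \<le> C * (cmod t * norm (v + w))\<^sup>2" "cmod b \<le> C * (cmod t * norm v)\<^sup>2"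
          "cmod c \<le> C * (cmod t * norm w)\<^sup>2"
        unfolding a_def b_def c_def using elim R zv by (intro est; simp)+
      have "t * F t = b + c - a"
        by (simp add: F_def a_def b_def c_def vector_add_ldistrib algebra_simps)
      then have "cmod t * cmod (F t) = cmod (b + c - a)"
        by (metis norm_mult)
      also have "\<dots> \<le> cmod b + cmod c + cmod a"
        using norm_triangle_ineq4[of "b + c" a] norm_triangle_ineq[of b c] by linarith
      also have "\<dots> \<le> cmod t * (C * B * cmod t)"
        using bnd by (simp add: B_def power2_eq_square algebra_simps)
      finally show ?case using t0 by simp
    qed
    show "((\<lambda>t. C * B * cmod t) \<longlongrightarrow> 0) (at 0)"
      by (intro tendsto_eq_intros refl) auto
  qed
  moreover have "(F \<longlongrightarrow> dir_deriv f (v + w) z - dir_deriv f v z - dir_deriv f w z) (at 0)"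
  proof -
    have "isCont (dir_deriv f w) z"
      using line_holo_continuous[OF line_holo_dir_deriv[OF f S(1)]] S continuous_on_eq_continuous_at by blast
    moreover have "((\<lambda>t. z + t *s v) \<longlongrightarrow> z) (at 0)"
      by (intro tendsto_eq_intros refl) auto
    ultimately have "((\<lambda>t. dir_deriv f w (z + t *s v)) \<longlongrightarrow> dir_deriv f w z) (at 0)"
      by (rule isCont_tendsto_compose)
    then show ?thesis unfolding F_def by (intro tendsto_intros)
  qed
  ultimately have "dir_deriv f (v + w) z - dir_deriv f v z - dir_deriv f w z = 0"
    using tendsto_unique[OF at_neq_bot] by blast
  then show ?thesis by (simp add: algebra_simps)
qed

text \<open>Osgood's lemma. The estimate with \<open>t = 1\<close> in direction \<open>h\<close> is
  the Frechet remainder; it is used with radius \<open>2 * R\<close>, which explains the restriction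
  to \<open>norm h < R / 2\<close>.\<close>

lemma line_holo_has_derivative:
  fixes f :: "complex^'n \<Rightarrow> complex"
  assumes f: "line_holo S f" and S: "open S" "z \<in> S"
  shows "(f has_derivative (\<lambda>v. dir_deriv f v z)) (at z)"
proof -
  have "linear (\<lambda>v. dir_deriv f v z)"
  proof
    show "dir_deriv f (v + w) z = dir_deriv f v z + dir_deriv f w z" for v w
      by (rule dir_deriv_add[OF assms])
    show "dir_deriv f (r *\<^sub>R v) z = r *\<^sub>R dir_deriv f v z" for r v
    proof -
      have "r *\<^sub>R v = complex_of_real r *s v"
        unfolding vec_eq_iff vector_scaleR_component vector_smult_component by (simp add: scaleR_conv_of_real)
      then show ?thesis using dir_deriv_scale[OF assms] by (simp add: scaleR_conv_of_real)
    qed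
  qed
  moreover have "(\<lambda>h. norm (f (z + h) - f z - dir_deriv f h z) / norm h) \<midarrow>0\<rightarrow> 0"
  proof -
    obtain R M where R: "0 < R" and M0: "0 \<le> M" and sub: "ball z (2 * R) \<subseteq> S"
      and M: "\<And>w. w \<in> ball z (2 * R) \<Longrightarrow> cmod (f w) \<le> M"
      using line_holo_locally_bounded[OF assms] by metis
    show ?thesis
    proof (rule Lim_null_comparison[where g = "\<lambda>h. 8 * M / (2 * R)\<^sup>2 * norm h"])
      show "\<forall>\<^sub>F h in at 0. norm (norm (f (z + h) - f z - dir_deriv f h z) / norm h) \<le> 8 * M / (2 * R)\<^sup>2 * norm h"
        using eventually_at_ball[of "R / 2" "0 :: complex^'n" UNIV]
      proof (rule eventually_mono)
        fix h :: "complex^'n" assume h: "h \<in> ball 0 (R / 2) \<and> h \<in> UNIV"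
        have "cmod (f (z + 1 *s h) - f z - 1 * dir_deriv f h z) \<le> 8 * M * (cmod 1 * norm h)\<^sup>2 / (2 * R)\<^sup>2"
          by (rule dir_deriv_estimate[OF f sub M]) (use h R in auto)
        then show "norm (norm (f (z + h) - f z - dir_deriv f h z) / norm h) \<le> 8 * M / (2 * R)\<^sup>2 * norm h"
          by (cases "h = 0") (auto simp: divide_le_eq power2_eq_square mult_ac)
      qed (use R in simp)
      show "((\<lambda>h. 8 * M / (2 * R)\<^sup>2 * norm h) \<longlongrightarrow> 0) (at (0 :: complex^'n))"
        by (intro tendsto_eq_intros refl) auto
    qed
  qed
  ultimately show ?thesis
    by (simp add: has_derivative_at linear_conv_bounded_linear)
qed

theorem holo_on_iff_line_holo:
  assumes "open S"
  shows "holo_on S f \<longleftrightarrow> line_holo S f"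
proof
  assume f: "line_holo S f"
  show "holo_on S f"
    unfolding holo_on_def
    using line_holo_has_derivative[OF f assms] dir_deriv_scale[OF f assms] has_derivative_at_withinI by blast
qed (rule holo_on_imp_line_holo[OF assms])

section \<open>Jacobians and coordinate curves\<close>

definition jacobian :: "('n::finite \<Rightarrow> complex^'n \<Rightarrow> complex) \<Rightarrow> complex^'n \<Rightarrow> complex^'n^'n" where
  "jacobian \<phi> z = (\<chi> i j. dir_deriv (\<phi> i) (axis j 1) z)"

lemma dir_deriv_eq_sum:
  assumes "line_holo S f" "open S" "z \<in> S"
  shows "dir_deriv f v z = (\<Sum>j\<in>UNIV. dir_deriv f (axis j 1) z * v $ j)"
proof -
  have lin: "linear (\<lambda>v. dir_deriv f v z)"
    using line_holo_has_derivative[OF assms] by (rule has_derivative_linear)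
  have "dir_deriv f v z = dir_deriv f (\<Sum>j\<in>UNIV. (v $ j) *s axis j 1) z"
    by (simp only: basis_expansion)
  also have "\<dots> = (\<Sum>j\<in>UNIV. dir_deriv f ((v $ j) *s axis j 1) z)"
    by (rule linear_sum[OF lin])
  finally show ?thesis by (simp add: dir_deriv_scale[OF assms] mult.commute)
qed

lemma jacobian_mult:
  assumes "line_holo S (\<phi> i)" "open S" "z \<in> S"
  shows "(jacobian \<phi> z *v v) $ i = dir_deriv (\<phi> i) v z"
  by (subst dir_deriv_eq_sum[OF assms]) (simp add: matrix_vector_mult_def jacobian_def)

lemma line_holo_det_jacobian:
  assumes "\<And>i. line_holo S (\<phi> i)" "open S"
  shows "line_holo S (\<lambda>z. det (jacobian \<phi> z))"
proof (rule line_holo_det)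
  show "line_holo S (\<lambda>z. jacobian \<phi> z $ i $ j)" for i j
    using line_holo_dir_deriv[OF assms] by (simp add: jacobian_def)
qed

lemma matrix_cancel_left:
  fixes A :: "complex^'n^'n"
  assumes "det A \<noteq> 0" "A *v x = A *v y"
  shows "x = y"
proof -
  obtain B where "B ** A = mat 1"
    using assms(1) invertible_det_nz invertible_left_inverse by blast
  then show ?thesis using assms(2) by (metis matrix_vector_mul_assoc matrix_vector_mul_lid)
qed

text \<open>By Cramer's rule, applied to the transposed Jacobian.\<close>

lemma dir_deriv_along_coordinate:
  fixes \<phi> :: "'n::finite \<Rightarrow> complex^'n \<Rightarrow> complex"
  assumes S: "open S" "z \<in> S" and \<phi>: "\<And>i. line_holo S (\<phi> i)" and f: "line_holo S f"
    and det: "det (jacobian \<phi> z) \<noteq> 0" and w: "jacobian \<phi> z *v w = axis j 1"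
  shows "dir_deriv f w z = det (jacobian (\<phi>(j := f)) z) / det (jacobian \<phi> z)"
proof -
  let ?A = "jacobian \<phi> z"
  define d where "d = (\<chi> k. dir_deriv f (axis k 1) z)"
  obtain B where "B ** transpose ?A = mat 1" "transpose ?A ** B = mat 1"
    using det invertible_det_nz[of "transpose ?A"] unfolding det_transpose invertible_def by blast
  then have c: "transpose ?A *v (B *v d) = d"
    by (simp add: matrix_vector_mul_assoc)
  define c where "c = B *v d"
  \<comment> \<open>The gradient of \<open>f\<close> is a combination of the gradients of the
    \<open>\<phi> i\<close>. Its \<open>j\<close>-th coefficient is the quotient of determinants by
    Cramer, and the derivative along \<open>w\<close> because the Jacobian sends \<open>w\<close> to
    the \<open>j\<close>-th unit vector.\<close>
  have d_row: "d = (\<Sum>i\<in>UNIV. c $ i *s row i ?A)"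
    by (subst c[folded c_def, symmetric])
       (simp add: vec_eq_iff matrix_vector_mult_def transpose_def row_def mult.commute)
  have "jacobian (\<phi>(j := f)) z = (\<chi> i. if i = j then (\<Sum>i\<in>UNIV. c $ i *s row i ?A) else row i ?A)"
    unfolding d_row[symmetric] by (simp add: vec_eq_iff jacobian_def d_def row_def)
  then have det_c: "det (jacobian (\<phi>(j := f)) z) = c $ j * det ?A"
    by (simp only: cramer_lemma_transpose)
  have "dir_deriv f w z = (\<Sum>k\<in>UNIV. d $ k * w $ k)"
    by (subst dir_deriv_eq_sum[OF f S]) (simp add: d_def)
  also have "\<dots> = (\<Sum>k\<in>UNIV. \<Sum>i\<in>UNIV. c $ i * (?A $ i $ k * w $ k))"
    by (subst d_row) (simp add: row_def sum_distrib_right mult.assoc)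
  also have "\<dots> = (\<Sum>i\<in>UNIV. c $ i * (?A *v w) $ i)"
    by (subst sum.swap) (simp add: matrix_vector_mult_def sum_distrib_left)
  also have "\<dots> = c $ j"
    unfolding w by (simp add: axis_def if_distrib cong: if_cong)
  finally show ?thesis using det_c det by simp
qed

lemma vec_has_derivative:
  fixes \<phi> :: "'n::finite \<Rightarrow> 'a::real_normed_vector \<Rightarrow> complex"
  assumes "\<And>i. (\<phi> i has_derivative D i) F"
  shows "((\<lambda>z. \<chi> i. \<phi> i z) has_derivative (\<lambda>v. \<chi> i. D i v)) F"
proof -
  have eq: "(\<chi> i. a i) = (\<Sum>i\<in>UNIV. a i *s axis i (1::complex))" for a :: "'n \<Rightarrow> complex"
    using basis_expansion[of "\<chi> i. a i"] by simp
  show ?thesis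
    unfolding eq by (intro has_derivative_sum bounded_linear.has_derivative[OF bounded_linear_vector_scalar_mult_left] assms)
qed

text \<open>The real inverse function theorem does the work. The derivative of the inverse is
  complex linear since the invertible Jacobian, itself complex linear, can be cancelled.\<close>

lemma holomorphic_inverse_function:
  fixes \<phi> :: "'n::finite \<Rightarrow> complex^'n \<Rightarrow> complex"
  assumes V: "open V" "p \<in> V" and \<phi>: "\<And>i. line_holo V (\<phi> i)" and det: "det (jacobian \<phi> p) \<noteq> 0"
  obtains U W g where "open U" "p \<in> U" "U \<subseteq> V" "\<forall>x\<in>U. det (jacobian \<phi> x) \<noteq> 0" "open W"
    "homeomorphism U W (\<lambda>z. \<chi> i. \<phi> i z) g"
    "\<forall>y\<in>W. \<exists>g'. (g has_derivative g') (at y) \<and> (\<forall>v. jacobian \<phi> (g y) *v g' v = v) \<and>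
        (\<forall>c v. g' (c *s v) = c *s g' v)"
proof -
  let ?F = "\<lambda>z. \<chi> i. \<phi> i z"
  define V' where "V' = V \<inter> (\<lambda>z. det (jacobian \<phi> z)) -` (- {0})"
  have V': "open V'" "p \<in> V'" "V' \<subseteq> V"
  proof -
    show "open V'"
      unfolding V'_def using line_holo_continuous[OF line_holo_det_jacobian[OF \<phi> V(1)]] V(1)
      by (intro continuous_open_preimage) auto
  qed (use V det in \<open>auto simp: V'_def\<close>)
  have blin: "bounded_linear ((*v) (A :: complex^'n^'n))" for A
  proof -
    have "linear ((*v) A)"
      by (intro linearI) (auto simp: matrix_vector_right_distrib vec_eq_iff matrix_vector_mult_def scaleR_sum_right
            distrib_left sum.distrib)
    then show ?thesis by (simp add: linear_conv_bounded_linear)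
  qed
  define f' where "f' = (\<lambda>z. Blinfun ((*v) (jacobian \<phi> z)))"
  have f': "blinfun_apply (f' z) v = jacobian \<phi> z *v v" for z v
    by (simp add: f'_def bounded_linear_Blinfun_apply[OF blin])
  have der: "(?F has_derivative blinfun_apply (f' x)) (at x)" if "x \<in> V'" for x
  proof -
    have x: "x \<in> V" using that V'(3) by blast
    have "(?F has_derivative (\<lambda>v. \<chi> i. dir_deriv (\<phi> i) v x)) (at x)"
      by (rule vec_has_derivative) (rule line_holo_has_derivative[OF \<phi> V(1) x])
    moreover have "(\<lambda>v. \<chi> i. dir_deriv (\<phi> i) v x) = blinfun_apply (f' x)"
      by (rule ext) (simp add: vec_eq_iff f' jacobian_mult[OF \<phi> V(1) x])
    ultimately show ?thesis by simp
  qed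
  have cont: "continuous_on V' f'"
  proof (rule continuous_on_blinfun_componentwise)
    fix b :: "complex^'n"
    have "continuous_on V' (\<lambda>x. \<chi> i. dir_deriv (\<phi> i) b x)"
      by (intro continuous_on_vec_lambda continuous_on_subset[OF _ V'(3)]
          line_holo_continuous[OF line_holo_dir_deriv[OF \<phi> V(1)]])
    moreover have "(\<chi> i. dir_deriv (\<phi> i) b x) = blinfun_apply (f' x) b" if "x \<in> V'" for x
      using that V'(3) by (simp add: vec_eq_iff f' jacobian_mult[OF \<phi> V(1) subsetD])
    ultimately show "continuous_on V' (\<lambda>x. blinfun_apply (f' x) b)"
      by (rule continuous_on_eq)
  qed
  obtain B where B: "B ** jacobian \<phi> p = mat 1"
    using det invertible_det_nz invertible_left_inverse by blast
  have "Blinfun ((*v) B) o\<^sub>L f' p = id_blinfun"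
    by (rule blinfun_eqI)
       (simp add: f' bounded_linear_Blinfun_apply[OF blin] matrix_vector_mul_assoc B)
  from inverse_function_theorem[OF V'(1) der cont V'(2) this]
  obtain U W g g' where U: "open U" "U \<subseteq> V'" "p \<in> U" "open W" "homeomorphism U W ?F g"
    and g: "\<And>y. y \<in> W \<Longrightarrow> (g has_derivative (g' y)) (at y)"
      "\<And>y. y \<in> W \<Longrightarrow> g' y = inv (blinfun_apply (f'(g y)))"
      "\<And>y. y \<in> W \<Longrightarrow> bij (blinfun_apply (f'(g y)))"
    by metis
  have nz: "\<forall>x\<in>U. det (jacobian \<phi> x) \<noteq> 0"
    using U(2) by (auto simp: V'_def)
  show thesis
  proof (rule that[OF U(1,3) _ nz U(4,5)])
    show "U \<subseteq> V" using U(2) V'(3) by blast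
    show "\<forall>y\<in>W. \<exists>g'. (g has_derivative g') (at y) \<and> (\<forall>v. jacobian \<phi> (g y) *v g' v = v) \<and>
        (\<forall>c v. g' (c *s v) = c *s g' v)"
    proof
      fix y assume y: "y \<in> W"
      have gy: "g y \<in> U" using U(5) y by (auto simp: homeomorphism_def)
      have inv: "jacobian \<phi> (g y) *v g' y v = v" for v
        using surj_f_inv_f[OF bij_is_surj[OF g(3)[OF y]], of v] unfolding g(2)[OF y] f' .
      have "g' y (c *s v) = c *s g' y v" for c v
        by (rule matrix_cancel_left[OF nz[rule_format, OF gy]]) (simp add: inv vec.scale vector_scalar_commute)
      with inv g(1)[OF y]
      show "\<exists>g'. (g has_derivative g') (at y) \<and> (\<forall>v. jacobian \<phi> (g y) *v g' v = v) \<and>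
          (\<forall>c v. g' (c *s v) = c *s g' v)" by blast
    qed
  qed
qed

text \<open>\<gamma> is the preimage of a complex line parallel to the \<open>j\<close>-th axis
  under the local coordinates \<phi>. Its velocity is the vector that the Jacobian sends to the
  \<open>j\<close>-th unit vector, which is where Cramer's formula applies.\<close>

lemma coordinate_curve:
  fixes \<phi> :: "'n::finite \<Rightarrow> complex^'n \<Rightarrow> complex"
  assumes V: "open V" "p \<in> V" and \<phi>: "\<And>i. line_holo V (\<phi> i)" and det: "det (jacobian \<phi> p) \<noteq> 0"
  obtains \<epsilon> \<gamma> where "\<epsilon> > 0" "\<gamma> 0 = p" "\<And>t. t \<in> ball 0 \<epsilon> \<Longrightarrow> \<gamma> t \<in> V"
    "\<And>t. t \<in> ball 0 \<epsilon> \<Longrightarrow> det (jacobian \<phi> (\<gamma> t)) \<noteq> 0"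
    "\<And>t. t \<in> ball 0 \<epsilon> \<Longrightarrow> \<phi> j (\<gamma> t) = \<phi> j p + t"
    "\<And>f t. line_holo V f \<Longrightarrow> t \<in> ball 0 \<epsilon> \<Longrightarrow>
       ((\<lambda>t. f (\<gamma> t)) has_field_derivative
          det (jacobian (\<phi>(j := f)) (\<gamma> t)) / det (jacobian \<phi> (\<gamma> t))) (at t)"
proof -
  let ?F = "\<lambda>z. \<chi> i. \<phi> i z"
  obtain U W g where U: "open U" "p \<in> U" "U \<subseteq> V" "\<forall>x\<in>U. det (jacobian \<phi> x) \<noteq> 0"
    and W: "open W" and hom: "homeomorphism U W ?F g"
    and g: "\<forall>y\<in>W. \<exists>g'. (g has_derivative g') (at y) \<and> (\<forall>v. jacobian \<phi> (g y) *v g' v = v) \<and>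
        (\<forall>c v. g' (c *s v) = c *s g' v)"
    by (rule holomorphic_inverse_function[OF assms], rule that)
  let ?l = "\<lambda>t. ?F p + t *s axis j 1"
  have "?F p \<in> W" using hom U(2) by (auto simp: homeomorphism_def)
  then have "0 \<in> {t. ?l t \<in> W}" by simp
  then obtain \<epsilon> where \<epsilon>: "\<epsilon> > 0" "ball 0 \<epsilon> \<subseteq> {t. ?l t \<in> W}"
    using open_line_preimage[OF W] open_contains_ball by blast
  have l: "?l t \<in> W" if "t \<in> ball 0 \<epsilon>" for t :: complex
    using \<epsilon>(2) that by blast
  define \<gamma> where "\<gamma> = (\<lambda>t. g (?l t))"
  have \<gamma>U: "\<gamma> t \<in> U" if "t \<in> ball 0 \<epsilon>" for t :: complex
    using l[OF that] hom by (auto simp: \<gamma>_def homeomorphism_def)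
  have F\<gamma>: "?F (\<gamma> t) = ?l t" if "t \<in> ball 0 \<epsilon>" for t :: complex
    using l[OF that] hom by (simp add: \<gamma>_def homeomorphism_def)
  show thesis
  proof (rule that[OF \<epsilon>(1)])
    show "\<gamma> 0 = p" using hom U(2) by (simp add: \<gamma>_def homeomorphism_def)
    show "\<gamma> t \<in> V" "det (jacobian \<phi> (\<gamma> t)) \<noteq> 0" if "t \<in> ball 0 \<epsilon>" for t :: complex
      using \<gamma>U[OF that] U(3,4) by blast+
    show "\<phi> j (\<gamma> t) = \<phi> j p + t" if "t \<in> ball 0 \<epsilon>" for t :: complex
      using arg_cong[OF F\<gamma>[OF that], of "\<lambda>v. v $ j"] by (simp add: axis_def)
    fix f and t :: complex assume f: "line_holo V f" and t: "t \<in> ball 0 \<epsilon>"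
    have \<gamma>t: "\<gamma> t \<in> V" using \<gamma>U[OF t] U(3) by blast
    obtain g' where g': "(g has_derivative g') (at (?l t))" "\<And>v. jacobian \<phi> (\<gamma> t) *v g' v = v"
        "\<And>c v. g' (c *s v) = c *s g' v"
      using g[rule_format, OF l[OF t]] unfolding \<gamma>_def by blast
    have "(?l has_derivative (\<lambda>h. h *s axis j 1)) (at t)"
      using bounded_linear_imp_has_derivative[OF bounded_linear_vector_scalar_mult_left]
      by (auto intro!: derivative_eq_intros)
    from has_derivative_compose[OF this g'(1)]
    have "(\<gamma> has_derivative (\<lambda>h. h *s g' (axis j 1))) (at t)"
      unfolding \<gamma>_def g'(3) .
    from has_derivative_compose[OF this line_holo_has_derivative[OF f V(1) \<gamma>t]]
    have "((\<lambda>t. f (\<gamma> t)) has_derivative (\<lambda>h. h * dir_deriv f (g' (axis j 1)) (\<gamma> t))) (at t)"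
      unfolding dir_deriv_scale[OF f V(1) \<gamma>t] .
    moreover have "dir_deriv f (g' (axis j 1)) (\<gamma> t) =
        det (jacobian (\<phi>(j := f)) (\<gamma> t)) / det (jacobian \<phi> (\<gamma> t))"
      using \<gamma>U[OF t] U(4) by (intro dir_deriv_along_coordinate[OF V(1) \<gamma>t \<phi> f _ g'(2)]) blast
    ultimately show "((\<lambda>t. f (\<gamma> t)) has_field_derivative
          det (jacobian (\<phi>(j := f)) (\<gamma> t)) / det (jacobian \<phi> (\<gamma> t))) (at t)"
      by (simp only: has_field_derivative_def mult_commute_abs)
  qed
qed

text \<open>Continuity keeps \<Psi> near \<open>y\<close> in the set where the local inverse
  \<open>g\<close> undoes \<phi>; there \<Psi> is \<open>g\<close> composed with a holomorphic
  map.\<close>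

lemma holomorphic_if_coordinates_holomorphic:
  fixes \<phi> :: "'n::finite \<Rightarrow> complex^'n \<Rightarrow> complex" and \<Psi> :: "complex \<Rightarrow> complex^'n"
  assumes V: "open V" and \<phi>: "\<And>i. line_holo V (\<phi> i)" and det: "det (jacobian \<phi> (\<Psi> y)) \<noteq> 0"
    and D: "open D" "y \<in> D" and cont: "continuous_on D \<Psi>" and sub: "\<Psi> ` D \<subseteq> V"
    and holo: "\<And>i. (\<lambda>t. \<phi> i (\<Psi> t)) holomorphic_on D"
  shows "\<exists>w. (\<Psi> has_derivative (\<lambda>h. h *s w)) (at y)"
proof -
  let ?F = "\<lambda>z. \<chi> i. \<phi> i z"
  have y: "\<Psi> y \<in> V" using D(2) sub by blast
  obtain U W g where U: "open U" "\<Psi> y \<in> U" "U \<subseteq> V" "\<forall>x\<in>U. det (jacobian \<phi> x) \<noteq> 0"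
    and W: "open W" and hom: "homeomorphism U W ?F g"
    and g: "\<forall>y\<in>W. \<exists>g'. (g has_derivative g') (at y) \<and> (\<forall>v. jacobian \<phi> (g y) *v g' v = v) \<and>
        (\<forall>c v. g' (c *s v) = c *s g' v)"
    by (rule holomorphic_inverse_function[OF V y \<phi> det], rule that)
  have "?F (\<Psi> y) \<in> W" using hom U(2) by (auto simp: homeomorphism_def)
  then obtain g' where g': "(g has_derivative g') (at (?F (\<Psi> y)))" "\<And>c v. g' (c *s v) = c *s g' v"
    using g by blast
  have "((\<lambda>t. \<chi> i. \<phi> i (\<Psi> t)) has_derivative (\<lambda>h. \<chi> i. deriv (\<lambda>t. \<phi> i (\<Psi> t)) y * h)) (at y)"
    by (rule vec_has_derivative)
       (use holomorphic_derivI[OF holo D] in \<open>simp add: has_field_derivative_def\<close>)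
  moreover have "(\<chi> i. deriv (\<lambda>t. \<phi> i (\<Psi> t)) y * h) = h *s (\<chi> i. deriv (\<lambda>t. \<phi> i (\<Psi> t)) y)" for h
    by (simp add: vec_eq_iff mult.commute)
  ultimately have "((\<lambda>t. ?F (\<Psi> t)) has_derivative (\<lambda>h. h *s (\<chi> i. deriv (\<lambda>t. \<phi> i (\<Psi> t)) y))) (at y)"
    by simp
  from has_derivative_compose[OF this g'(1)]
  have "((\<lambda>t. g (?F (\<Psi> t))) has_derivative (\<lambda>h. h *s g' (\<chi> i. deriv (\<lambda>t. \<phi> i (\<Psi> t)) y))) (at y)"
    unfolding g'(2) .
  then have "(\<Psi> has_derivative (\<lambda>h. h *s g' (\<chi> i. deriv (\<lambda>t. \<phi> i (\<Psi> t)) y))) (at y)"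
  proof (rule has_derivative_transform_within_open)
    show "open (D \<inter> \<Psi> -` U)" by (rule continuous_open_preimage[OF cont D(1) U(1)])
    show "y \<in> D \<inter> \<Psi> -` U" using D(2) U(2) by simp
    show "g (?F (\<Psi> t)) = \<Psi> t" if "t \<in> D \<inter> \<Psi> -` U" for t
      using that hom by (simp add: homeomorphism_def)
  qed
  then show ?thesis by blast
qed

lemma constant_if_derivation_vanishes:
  fixes h :: "'f \<Rightarrow> complex \<Rightarrow> complex"
  assumes der: "\<And>f t. f \<in> G \<Longrightarrow> t \<in> ball 0 \<epsilon> \<Longrightarrow> (h f has_field_derivative h (L f) t * u t) (at t)"
    and L: "\<And>f. f \<in> G \<Longrightarrow> L f \<in> G" "\<And>f. f \<in> G \<Longrightarrow> h (L f) 0 = 0"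
    and u: "u holomorphic_on ball 0 \<epsilon>" and \<epsilon>: "0 < \<epsilon>" and f: "f \<in> G" and t: "t \<in> ball 0 \<epsilon>"
  shows "h f t = h f 0"
proof -
  have holo: "h f holomorphic_on ball 0 \<epsilon>" if "f \<in> G" for f
    unfolding holomorphic_on_open[OF open_ball] using der[OF that] by blast
  have 0: "0 \<in> ball (0::complex) \<epsilon>" using \<epsilon> by simp
  have "(deriv ^^ i) (h (L f)) 0 = 0" if "f \<in> G" for i f
    using that
  proof (induction i arbitrary: f rule: less_induct)
    case (less i)
    show ?case
    proof (cases i)
      case 0
      then show ?thesis using L(2)[OF less.prems] by simp
    next
      case (Suc k)
      have G: "L f \<in> G" "L (L f) \<in> G" using L less.prems by blast+
      have "(deriv ^^ i) (h (L f)) 0 = (deriv ^^ k) (deriv (h (L f))) 0"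
        unfolding Suc by (simp add: funpow_Suc_right del: funpow.simps)
      also have "\<dots> = (deriv ^^ k) (\<lambda>t. h (L (L f)) t * u t) 0"
      proof (rule higher_deriv_transform_within_open)
        show "deriv (h (L f)) holomorphic_on ball 0 \<epsilon>"
          by (intro holomorphic_deriv holo G open_ball)
        show "(\<lambda>t. h (L (L f)) t * u t) holomorphic_on ball 0 \<epsilon>"
          by (intro holomorphic_intros holo G u)
        show "deriv (h (L f)) t = h (L (L f)) t * u t" if "t \<in> ball 0 \<epsilon>" for t :: complex
          by (rule DERIV_imp_deriv[OF der[OF G(1) that]])
      qed (use \<epsilon> in auto)
      also have "\<dots> = (\<Sum>j = 0..k. of_nat (k choose j) * (deriv ^^ j) (h (L (L f))) 0 * (deriv ^^ (k - j)) u 0)"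
        by (rule higher_deriv_mult[OF holo[OF G(2)] u open_ball 0])
      also have "\<dots> = 0"
        using less.IH[OF _ G(1)] Suc by (intro sum.neutral) simp
      finally show ?thesis .
    qed
  qed
  from holomorphic_fun_eq_0_on_ball[OF holo[OF L(1)[OF f]] _ this[OF f]]
  have "(h f has_field_derivative 0) (at s within ball 0 \<epsilon>)" if "s \<in> ball 0 \<epsilon>" for s
    using der[OF f that] that by (simp add: has_field_derivative_at_within)
  then obtain c where "\<forall>x\<in>ball 0 \<epsilon>. h f x = c"
    using has_field_derivative_zero_constant[OF convex_ball] by blast
  then show ?thesis using 0 t by metis
qed

text \<open>
  Among the systems of \<open>n\<close> holomorphic functions that form a coordinate system at some point of
  the disc's image, choose one with as many members as possible in the algebra \<open>G\<close> of functions
  whose pullback is holomorphic. If the \<open>j\<close>-th one is not in \<open>G\<close>, then maximality makes the Jacobian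
  \<open>L f\<close> obtained by replacing it with any \<open>f \<in> G\<close> vanish on the image, so that \<open>L\<close> maps \<open>G\<close> into
  itself. As \<open>L\<close> is differentiation along the \<open>j\<close>-th coordinate curve up to a factor, all of \<open>G\<close>
  is constant on that curve, against separation of points. Hence a coordinate system lies in \<open>G\<close>,
  and Rado's theorem takes care of the zeros of its Jacobian.
\<close>

theorem holomorphic_disc_if_separating:
  fixes \<Psi> :: "complex \<Rightarrow> complex^'n"
  assumes cont: "continuous_on (cball 0 1) \<Psi>" and V: "open V" "\<Psi> ` cball 0 1 \<subseteq> V"
    and line: "\<And>f. f \<in> H \<Longrightarrow> line_holo V f" and holo: "\<And>f. f \<in> H \<Longrightarrow> (\<lambda>t. f (\<Psi> t)) holomorphic_on ball 0 1"
    and sep: "\<And>x y. x \<in> V \<Longrightarrow> y \<in> V \<Longrightarrow> (\<And>f. f \<in> H \<Longrightarrow> f x = f y) \<Longrightarrow> x = y"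
  shows "(\<lambda>t. \<Psi> t $ k) holomorphic_on ball 0 1"
proof -
  define G where "G = {f. line_holo V f \<and> (\<lambda>t. f (\<Psi> t)) holomorphic_on ball 0 1}"
  define P where "P = (\<lambda>(\<phi>, y). y \<in> ball 0 1 \<and> (\<forall>i. line_holo V (\<phi> i)) \<and> det (jacobian \<phi> (\<Psi> y)) \<noteq> 0)"
  define r where "r = (\<lambda>(\<phi> :: 'n \<Rightarrow> complex^'n \<Rightarrow> complex, y :: complex). card {i. \<phi> i \<in> G})"
  \<comment> \<open>The standard coordinates show that there is a system to maximise over.\<close>
  have "P (\<lambda>i z. z $ i, 0)"
  proof -
    have "dir_deriv (\<lambda>z. z $ i) (axis j 1) z = (axis j 1 :: complex^'n) $ i" for i j z
      unfolding dir_deriv_def by (rule DERIV_imp_deriv) (auto intro!: derivative_eq_intros)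
    then have "jacobian (\<lambda>i z. z $ i) (\<Psi> 0) = (mat 1 :: complex^'n^'n)"
      by (auto simp: jacobian_def vec_eq_iff mat_def axis_def)
    then show ?thesis by (simp add: P_def line_holo_component)
  qed
  moreover have "\<forall>x. P x \<longrightarrow> r x < Suc CARD('n)"
    by (auto simp: r_def less_Suc_eq_le intro: card_mono)
  ultimately obtain x where x: "P x" "\<And>x'. P x' \<Longrightarrow> r x' \<le> r x"
    using ex_has_greatest_nat[of P _ r "Suc CARD('n)"] by blast
  obtain \<phi> y where xy: "x = (\<phi>, y)" by (cases x)
  have y: "y \<in> ball 0 1" and \<phi>: "\<And>i. line_holo V (\<phi> i)" and det: "det (jacobian \<phi> (\<Psi> y)) \<noteq> 0"
    using x(1) by (auto simp: P_def xy)
  have \<Psi>V: "\<Psi> t \<in> V" if "t \<in> ball 0 1" for t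
    using V(2) that ball_subset_cball by blast
  have "\<phi> j \<in> G" for j
  proof (rule ccontr)
    assume j: "\<phi> j \<notin> G"
    define L where "L = (\<lambda>f z. det (jacobian (\<phi>(j := f)) z))"
    have line_L: "line_holo V (L f)" if "f \<in> G" for f
      unfolding L_def using that \<phi> by (intro line_holo_det_jacobian V) (simp add: G_def)
    have L0: "L f (\<Psi> t) = 0" if f: "f \<in> G" and t: "t \<in> ball 0 1" for f t
    proof (rule ccontr)
      assume "L f (\<Psi> t) \<noteq> 0"
      then have "P (\<phi>(j := f), t)" using f t \<phi> by (auto simp: P_def L_def G_def)
      from x(2)[OF this] have "card {i. (\<phi>(j := f)) i \<in> G} \<le> card {i. \<phi> i \<in> G}"
        by (simp add: r_def xy)
      moreover have "{i. (\<phi>(j := f)) i \<in> G} = insert j {i. \<phi> i \<in> G}" using f by auto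
      ultimately show False using j by simp
    qed
    have L: "L f \<in> G" if f: "f \<in> G" for f
    proof -
      have "(\<lambda>t. L f (\<Psi> t)) holomorphic_on ball 0 1"
        by (rule holomorphic_transform[of "\<lambda>_. 0"]) (use L0[OF f] in auto)
      then show ?thesis using line_L[OF f] by (simp add: G_def)
    qed
    obtain \<epsilon> \<gamma> where \<epsilon>: "\<epsilon> > 0" and \<gamma>: "\<gamma> 0 = \<Psi> y" "\<And>t. t \<in> ball 0 \<epsilon> \<Longrightarrow> \<gamma> t \<in> V"
      "\<And>t. t \<in> ball 0 \<epsilon> \<Longrightarrow> det (jacobian \<phi> (\<gamma> t)) \<noteq> 0"
      "\<And>t. t \<in> ball 0 \<epsilon> \<Longrightarrow> \<phi> j (\<gamma> t) = \<phi> j (\<Psi> y) + t"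
      and der: "\<And>f t. line_holo V f \<Longrightarrow> t \<in> ball 0 \<epsilon> \<Longrightarrow>
       ((\<lambda>t. f (\<gamma> t)) has_field_derivative
          det (jacobian (\<phi>(j := f)) (\<gamma> t)) / det (jacobian \<phi> (\<gamma> t))) (at t)"
      using coordinate_curve[OF V(1) \<Psi>V[OF y] \<phi> det, of j] by metis
    define u where "u = (\<lambda>t. 1 / det (jacobian \<phi> (\<gamma> t)))"
    have "(\<lambda>t. det (jacobian \<phi> (\<gamma> t))) holomorphic_on ball 0 \<epsilon>"
      unfolding holomorphic_on_open[OF open_ball] using der[OF line_holo_det_jacobian[of V \<phi>, OF \<phi> V(1)]] by blast
    then have u: "u holomorphic_on ball 0 \<epsilon>"
      unfolding u_def using \<gamma>(3) by (intro holomorphic_intros) auto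
    have const: "f (\<gamma> t) = f (\<gamma> 0)" if "f \<in> G" "t \<in> ball 0 \<epsilon>" for f t
    proof (rule constant_if_derivation_vanishes[of G \<epsilon> "\<lambda>f t. f (\<gamma> t)" L u, OF _ L _ u \<epsilon> that])
      show "((\<lambda>t. f (\<gamma> t)) has_field_derivative L f (\<gamma> t) * u t) (at t)"
        if "f \<in> G" "t \<in> ball 0 \<epsilon>" for f t
        using der[OF _ that(2), of f] that(1) by (simp add: G_def L_def u_def)
      show "L f (\<gamma> 0) = 0" if "f \<in> G" for f
        using L0[OF that y] \<gamma>(1) by simp
    qed
    define t where "t = complex_of_real (\<epsilon> / 2)"
    have t: "t \<in> ball 0 \<epsilon>" "t \<noteq> 0" using \<epsilon> by (auto simp: t_def)
    have "\<gamma> t = \<gamma> 0"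
    proof (rule sep)
      show "\<gamma> t \<in> V" "\<gamma> 0 \<in> V" using \<gamma>(2) t(1) \<epsilon> by auto
      show "f (\<gamma> t) = f (\<gamma> 0)" if "f \<in> H" for f
        using const[OF _ t(1)] that line holo by (simp add: G_def)
    qed
    then show False using \<gamma>(4)[OF t(1)] \<gamma>(1) t(2) by simp
  qed
  then have \<phi>\<Psi>: "(\<lambda>t. \<phi> i (\<Psi> t)) holomorphic_on ball 0 1" for i
    by (simp add: G_def)
  define J where "J = (\<lambda>z. det (jacobian \<phi> z))"
  have J: "line_holo V J"
    unfolding J_def by (rule line_holo_det_jacobian[OF \<phi> V(1)])
  have der: "\<exists>w. (\<Psi> has_derivative (\<lambda>h. h *s w)) (at t)" if "t \<in> {t\<in>ball 0 1. J (\<Psi> t) \<noteq> 0}" for t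
    using that \<phi>\<Psi> \<Psi>V cont
    by (intro holomorphic_if_coordinates_holomorphic[OF V(1) \<phi>, where D = "ball 0 1"])
       (auto simp: J_def intro: continuous_on_subset[OF _ ball_subset_cball])
  show ?thesis
  \<comment> \<open>It is not known beforehand that \<open>J\<close> lies in \<open>G\<close>: its
    pullback is only seen to be holomorphic where it is nonzero, which is all that
    \<open>rado\<close> asks of \<open>g\<close>.\<close>
  proof (rule rado[where g = "\<lambda>t. J (\<Psi> t)", OF _ _ _ _ y])
    show "continuous_on (cball 0 1) (\<lambda>t. J (\<Psi> t))"
      by (rule continuous_on_compose2[OF line_holo_continuous[OF J] cont V(2)])
    show "continuous_on (cball 0 1) (\<lambda>t. \<Psi> t $ k)"
      by (intro continuous_on_component cont)
    show "J (\<Psi> y) \<noteq> 0" using det by (simp add: J_def)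
    show "(\<lambda>t. J (\<Psi> t)) holomorphic_on {t\<in>ball 0 1. J (\<Psi> t) \<noteq> 0}"
      unfolding holomorphic_on_def
    proof
      fix t assume t: "t \<in> {t\<in>ball 0 1. J (\<Psi> t) \<noteq> 0}"
      then obtain w where "(\<Psi> has_derivative (\<lambda>h. h *s w)) (at t)" using der by blast
      from has_derivative_compose[OF this line_holo_has_derivative[OF J V(1) \<Psi>V]]
      have "((\<lambda>t. J (\<Psi> t)) has_derivative (\<lambda>h. dir_deriv J w (\<Psi> t) * h)) (at t)"
        using t by (simp add: dir_deriv_scale[OF J V(1) \<Psi>V] mult.commute)
      then show "(\<lambda>t. J (\<Psi> t)) field_differentiable (at t within {t\<in>ball 0 1. J (\<Psi> t) \<noteq> 0})"
        unfolding field_differentiable_def has_field_derivative_def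
        using has_derivative_at_withinI by blast
    qed
    show "(\<lambda>t. \<Psi> t $ k) holomorphic_on {t\<in>ball 0 1. J (\<Psi> t) \<noteq> 0}"
      unfolding holomorphic_on_def
    proof
      fix t assume "t \<in> {t\<in>ball 0 1. J (\<Psi> t) \<noteq> 0}"
      then obtain w where "(\<Psi> has_derivative (\<lambda>h. h *s w)) (at t)" using der by blast
      from bounded_linear.has_derivative[OF bounded_linear_vec_nth this, of k]
      have "((\<lambda>t. \<Psi> t $ k) has_derivative (\<lambda>h. w $ k * h)) (at t)"
        by (simp add: mult.commute)
      then show "(\<lambda>t. \<Psi> t $ k) field_differentiable (at t within {t\<in>ball 0 1. J (\<Psi> t) \<noteq> 0})"
        unfolding field_differentiable_def has_field_derivative_def
        using has_derivative_at_withinI by blast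
    qed
  qed
qed

section \<open>Maps between manifolds\<close>

lemma line_holo_transform:
  assumes f: "line_holo S f" and eq: "\<And>z. z \<in> S \<Longrightarrow> f z = g z"
  shows "line_holo S g"
  unfolding line_holo_def
proof (intro conjI allI)
  show "continuous_on S g"
    using line_holo_continuous[OF f] eq by (rule continuous_on_eq)
  show "(\<lambda>t. g (z + t *s v)) holomorphic_on {t. z + t *s v \<in> S}" for z v
    using line_holo_line[OF f] by (rule holomorphic_transform) (simp add: eq)
qed

lemma line_holo_compose:
  fixes \<Psi> :: "complex^'m \<Rightarrow> complex^'n"
  assumes D: "open D" and V: "open V" and g: "line_holo V g" and \<Psi>: "\<And>k. line_holo D (\<lambda>z. \<Psi> z $ k)"
    and sub: "\<Psi> ` D \<subseteq> V"
  shows "line_holo D (\<lambda>z. g (\<Psi> z))"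
proof -
  have "holo_on D (\<lambda>z. g (\<Psi> z))"
    unfolding holo_on_def
  proof
    fix z assume z: "z \<in> D"
    then have \<Psi>z: "\<Psi> z \<in> V" using sub by blast
    let ?L = "\<lambda>v. \<chi> k. dir_deriv (\<lambda>z. \<Psi> z $ k) v z"
    have "((\<lambda>z. \<chi> k. \<Psi> z $ k) has_derivative ?L) (at z)"
      by (rule vec_has_derivative) (rule line_holo_has_derivative[OF \<Psi> D z])
    then have "(\<Psi> has_derivative ?L) (at z)" by simp
    from has_derivative_compose[OF this line_holo_has_derivative[OF g V \<Psi>z]]
    have "((\<lambda>z. g (\<Psi> z)) has_derivative (\<lambda>v. dir_deriv g (?L v) (\<Psi> z))) (at z)" .
    moreover have "?L (c *s v) = c *s ?L v" for c v
      by (simp add: vec_eq_iff dir_deriv_scale[OF \<Psi> D z])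
    then have "dir_deriv g (?L (c *s v)) (\<Psi> z) = c * dir_deriv g (?L v) (\<Psi> z)" for c v
      by (simp only: dir_deriv_scale[OF g V \<Psi>z])
    ultimately show "\<exists>L. ((\<lambda>z. g (\<Psi> z)) has_derivative L) (at z within D) \<and> (\<forall>c v. L (c *s v) = c * L v)"
      using has_derivative_at_withinI by blast
  qed
  then show ?thesis using holo_on_iff_line_holo[OF D] by blast
qed

text \<open>Continuity is given, so holomorphy on small discs in complex lines is enough, and there
  the one-variable result applies.\<close>

theorem line_holo_if_separating:
  fixes \<Psi> :: "complex^'m \<Rightarrow> complex^'n"
  assumes D: "open D" and V: "open V" and cont: "continuous_on D \<Psi>" and sub: "\<Psi> ` D \<subseteq> V"
    and line: "\<And>f. f \<in> H \<Longrightarrow> line_holo V f" and holo: "\<And>f. f \<in> H \<Longrightarrow> line_holo D (\<lambda>z. f (\<Psi> z))"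
    and sep: "\<And>x y. x \<in> V \<Longrightarrow> y \<in> V \<Longrightarrow> (\<And>f. f \<in> H \<Longrightarrow> f x = f y) \<Longrightarrow> x = y"
  shows "line_holo D (\<lambda>z. \<Psi> z $ k)"
  unfolding line_holo_def
proof (intro conjI allI)
  show "continuous_on D (\<lambda>z. \<Psi> z $ k)" by (intro continuous_on_component cont)
  fix z v
  have "(\<lambda>t. \<Psi> (z + t *s v) $ k) field_differentiable at t0" if t0: "z + t0 *s v \<in> D" for t0
  proof -
    obtain e where e: "e > 0" "cball t0 e \<subseteq> {t. z + t *s v \<in> D}"
      using open_line_preimage[OF D, of z v] t0 open_contains_cball by blast
    \<comment> \<open>Carries the closed unit disc onto \<open>cball t0 e\<close>, so the disc
      theorem can be used in its normalised form.\<close>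
    define a where "a = (\<lambda>s. t0 + complex_of_real e * s)"
    have aD: "z + a s *s v \<in> D" if "s \<in> cball 0 1" for s
    proof -
      have "a s \<in> cball t0 e"
        using that e(1) by (simp add: a_def dist_norm norm_mult)
      then show ?thesis using e(2) by blast
    qed
    have holo_a: "(\<lambda>s. \<Psi> (z + a s *s v) $ k) holomorphic_on ball 0 1"
    proof (rule holomorphic_disc_if_separating[where H = H and V = V])
      show "continuous_on (cball 0 1) (\<lambda>s. \<Psi> (z + a s *s v))"
      proof (rule continuous_on_compose2[OF cont])
        show "continuous_on (cball 0 1) (\<lambda>s. z + a s *s v)"
          unfolding a_def by (intro continuous_intros)
      qed (use aD in blast)
      show "(\<lambda>s. \<Psi> (z + a s *s v)) ` cball 0 1 \<subseteq> V" using aD sub by blast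
      fix f assume f: "f \<in> H"
      have "a holomorphic_on ball 0 1" unfolding a_def by (intro holomorphic_intros)
      moreover have "a ` ball 0 1 \<subseteq> {t. z + t *s v \<in> D}"
        using aD ball_subset_cball by blast
      ultimately show "(\<lambda>s. f (\<Psi> (z + a s *s v))) holomorphic_on ball 0 1"
        using holomorphic_on_compose_gen[OF _ line_holo_line[OF holo[OF f]], of a "ball 0 1" z v]
        by (auto simp: o_def)
    qed (use V line sep in blast)+
    have "(\<lambda>t. \<Psi> (z + a ((t - t0) / e) *s v) $ k) field_differentiable at t0"
    proof -
      have "(\<lambda>s. \<Psi> (z + a s *s v) $ k) field_differentiable at ((t0 - t0) / e)"
        using holo_a by (intro holomorphic_on_imp_differentiable_at[OF _ open_ball]) auto
      moreover have "(\<lambda>t. (t - t0) / complex_of_real e) field_differentiable at t0"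
        by (intro derivative_intros) (use e(1) in auto)
      ultimately show ?thesis
        using field_differentiable_compose[of "\<lambda>t. (t - t0) / complex_of_real e" t0] by (simp add: o_def)
    qed
    moreover have "a ((t - t0) / e) = t" for t using e(1) by (simp add: a_def)
    ultimately show ?thesis by simp
  qed
  then show "(\<lambda>t. \<Psi> (z + t *s v) $ k) holomorphic_on {t. z + t *s v \<in> D}"
    by (auto simp: holomorphic_on_def intro: field_differentiable_at_within)
qed

text \<open>Dividing by one function of the family turns the projective statement into the affine one.\<close>

theorem line_holo_if_projectively_separating:
  fixes \<Psi> :: "complex^'m \<Rightarrow> complex^'n"
  assumes D: "open D" and V: "open V" and cont: "continuous_on D \<Psi>" and sub: "\<Psi> ` D \<subseteq> V"
    and w: "\<And>z. z \<in> D \<Longrightarrow> w z \<noteq> 0"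
    and line: "\<And>f. f \<in> H \<Longrightarrow> line_holo V f"
    and holo: "\<And>f. f \<in> H \<Longrightarrow> line_holo D (\<lambda>z. w z * f (\<Psi> z))"
    and nz: "\<And>x. x \<in> V \<Longrightarrow> \<exists>g\<in>H. g x \<noteq> 0"
    and sep: "\<And>x y. x \<in> V \<Longrightarrow> y \<in> V \<Longrightarrow> x \<noteq> y \<Longrightarrow> \<exists>f\<in>H. \<exists>g\<in>H. f x * g y \<noteq> f y * g x"
  shows "line_holo D (\<lambda>z. \<Psi> z $ k)" and "line_holo D w"
proof -
  have "\<exists>D'. open D' \<and> z0 \<in> D' \<and> (\<forall>k. line_holo D' (\<lambda>z. \<Psi> z $ k)) \<and> line_holo D' w" if z0: "z0 \<in> D" for z0
  proof -
    have "\<Psi> z0 \<in> V" using z0 sub by blast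
    then obtain g where g: "g \<in> H" "g (\<Psi> z0) \<noteq> 0" using nz by blast
    define V' where "V' = V \<inter> g -` (- {0})"
    have V': "open V'" unfolding V'_def
      using line_holo_continuous[OF line[OF g(1)]] V by (intro continuous_open_preimage) auto
    define D' where "D' = D \<inter> \<Psi> -` V'"
    have D': "open D'" unfolding D'_def by (rule continuous_open_preimage[OF cont D V'])
    have sub': "D' \<subseteq> D" "\<Psi> ` D' \<subseteq> V'" "V' \<subseteq> V" by (auto simp: D'_def V'_def)
    have gnz: "g x \<noteq> 0" if "x \<in> V'" for x using that by (simp add: V'_def)
    have \<Psi>: "line_holo D' (\<lambda>z. \<Psi> z $ k)" for k
    proof (rule line_holo_if_separating[where V = V' and H = "(\<lambda>f x. f x / g x) ` H"])
      show "continuous_on D' \<Psi>" using cont sub'(1) by (rule continuous_on_subset)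
      show "line_holo V' q" if "q \<in> (\<lambda>f x. f x / g x) ` H" for q
        using that line g(1) line_holo_subset[OF _ sub'(3)] gnz by (auto intro!: line_holo_divide)
      show "line_holo D' (\<lambda>z. q (\<Psi> z))" if "q \<in> (\<lambda>f x. f x / g x) ` H" for q
      proof -
        obtain f where f: "f \<in> H" "q = (\<lambda>x. f x / g x)" using \<open>q \<in> _\<close> by blast
        have "line_holo D' (\<lambda>z. (w z * f (\<Psi> z)) / (w z * g (\<Psi> z)))"
        proof (intro line_holo_divide)
          show "line_holo D' (\<lambda>z. w z * f (\<Psi> z))" "line_holo D' (\<lambda>z. w z * g (\<Psi> z))"
            using line_holo_subset[OF holo sub'(1)] f(1) g(1) by blast+
          show "w z * g (\<Psi> z) \<noteq> 0" if "z \<in> D'" for z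
            using that w gnz sub' by (simp add: subset_iff image_subset_iff)
        qed
        moreover have "(w z * f (\<Psi> z)) / (w z * g (\<Psi> z)) = q (\<Psi> z)" if "z \<in> D'" for z
          using that w sub'(1) by (simp add: f(2) subset_iff)
        ultimately show ?thesis by (rule line_holo_transform)
      qed
      fix x y assume xy: "x \<in> V'" "y \<in> V'" and eq: "\<And>q. q \<in> (\<lambda>f x. f x / g x) ` H \<Longrightarrow> q x = q y"
      have ratio: "f x * g y = f y * g x" if "f \<in> H" for f
        using eq[OF imageI[OF that]] gnz[OF xy(1)] gnz[OF xy(2)] by (simp add: field_simps)
      show "x = y"
      proof (rule ccontr)
        assume "x \<noteq> y"
        then obtain f h where fh: "f \<in> H" "h \<in> H" "f x * h y \<noteq> f y * h x"
          using sep[of x y] xy sub'(3) by blast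
        \<comment> \<open>Multiplying the relations for \<open>f\<close> and \<open>h\<close> and
          cancelling the nonzero \<open>g x * g y\<close> contradicts the choice of \<open>f\<close>
          and \<open>h\<close>: quotients by one fixed \<open>g\<close> already separate points of
          \<open>V'\<close>.\<close>
        have "(f x * g y) * (h y * g x) = (f y * g x) * (h x * g y)"
          using ratio[OF fh(1)] ratio[OF fh(2)] by simp
        then have "(g x * g y) * (f x * h y) = (g x * g y) * (f y * h x)" by (simp only: mult_ac)
        then show False using fh(3) gnz xy by simp
      qed
    qed (use D' V' sub' in auto)
    \<comment> \<open>Once \<Psi> is known to be holomorphic, so is \<open>g\<close> along it, and
      the weight is recovered by division.\<close>
    have "line_holo D' (\<lambda>z. g (\<Psi> z))"
      by (rule line_holo_compose[OF D' V' line_holo_subset[OF line[OF g(1)] sub'(3)] \<Psi> sub'(2)])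
    then have "line_holo D' (\<lambda>z. (w z * g (\<Psi> z)) / g (\<Psi> z))"
      using gnz sub' by (intro line_holo_divide line_holo_subset[OF holo[OF g(1)] sub'(1)]) auto
    moreover have "(w z * g (\<Psi> z)) / g (\<Psi> z) = w z" if "z \<in> D'" for z
      using that gnz sub'(2) by (simp add: image_subset_iff)
    ultimately have "line_holo D' w" by (rule line_holo_transform)
    moreover have "z0 \<in> D'" using z0 \<open>\<Psi> z0 \<in> V\<close> g(2) by (simp add: D'_def V'_def)
    ultimately show ?thesis using D' \<Psi> by blast
  qed
  note local = this
  show "line_holo D (\<lambda>z. \<Psi> z $ k)"
  proof (rule line_holo_local[OF D])
    fix z assume "z \<in> D"
    from local[OF this] show "\<exists>U. open U \<and> z \<in> U \<and> line_holo U (\<lambda>z. \<Psi> z $ k)" by blast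
  qed
  show "line_holo D w"
  proof (rule line_holo_local[OF D])
    fix z assume "z \<in> D"
    from local[OF this] show "\<exists>U. open U \<and> z \<in> U \<and> line_holo U w" by blast
  qed
qed

text \<open>The case \<open>V = UNIV\<close> in the definition of \<open>complex_manifold\<close>.\<close>

definition charted :: "('a::t2_space, 'n::finite) atlas \<Rightarrow> bool" where
  "charted A \<longleftrightarrow> (\<forall>(U, \<phi>)\<in>A. chart UNIV U \<phi>) \<and> (\<Union>(U, \<phi>)\<in>A. U) = UNIV"

lemma charted_cover:
  assumes "charted A"
  obtains U \<phi> where "(U, \<phi>) \<in> A" "x \<in> U"
proof -
  have "x \<in> (\<Union>(U, \<phi>)\<in>A. U)" using assms by (simp add: charted_def)
  then show ?thesis using that by blast
qed

lemma charted_chart: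
  assumes "charted A" "(U, \<phi>) \<in> A"
  shows "open U" "open (\<phi> ` U)" "continuous_on U \<phi>" "continuous_on (\<phi> ` U) (inv_into U \<phi>)"
    "x \<in> U \<Longrightarrow> inv_into U \<phi> (\<phi> x) = x"
  using assms unfolding charted_def chart_def homeomorphism_def by auto

text \<open>Over the zero model space a chart is injective into a single point, so some singleton is
  open as well as closed, and connectedness makes it the whole space.\<close>

lemma complex_manifold_cases:
  fixes A :: "('a::t2_space, 'n::finite) atlas"
  assumes "complex_manifold A"
  shows "charted A \<or> (\<exists>x::'a. UNIV = {x}) \<and> (\<forall>(U, \<phi>)\<in>A. \<phi> ` U \<subseteq> {0})"
proof -
  obtain V where V: "V = UNIV \<or> V = {0}" "\<forall>(U, \<phi>)\<in>A. chart V U \<phi>"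
    and cover: "(\<Union>(U, \<phi>)\<in>A. U) = UNIV" and conn: "connected (UNIV :: 'a set)"
    using assms unfolding complex_manifold_def by (elim conjE exE) (rule that)
  show ?thesis
  proof (cases "V = UNIV")
    case True
    then show ?thesis using V(2) cover by (simp add: charted_def)
  next
    case False
    then have sub: "\<phi> ` U \<subseteq> {0}" if "(U, \<phi>) \<in> A" for U \<phi>
      using V that openin_imp_subset unfolding chart_def by fastforce
    obtain x :: 'a where "x \<in> UNIV" by blast
    then have "x \<in> (\<Union>(U, \<phi>)\<in>A. U)" using cover by simp
    then obtain U \<phi> where U: "(U, \<phi>) \<in> A" "x \<in> U" by blast
    have "chart V U \<phi>" using V(2) U(1) by blast
    then have "open U" "inj_on \<phi> U"
      unfolding chart_def homeomorphism_def by (auto intro: inj_on_inverseI)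
    moreover have "U = {x}"
    proof -
      have "u = x" if "u \<in> U" for u
        using sub[OF U(1)] that U(2) \<open>inj_on \<phi> U\<close> by (metis image_subset_iff inj_onD singletonD)
      then show ?thesis using U(2) by blast
    qed
    ultimately have "open {x}" "closed {x}" by simp_all
    then have "{x} = UNIV"
      using conn unfolding connected_clopen by (metis insert_not_empty open_openin closed_closedin subtopology_UNIV)
    then have "\<exists>x::'a. UNIV = {x}" by metis
    moreover have "\<forall>(U, \<phi>)\<in>A. \<phi> ` U \<subseteq> {0}" using sub by blast
    ultimately show ?thesis by simp
  qed
qed

lemma holomorphic_fun_line_holo:
  assumes "charted A" "holomorphic_fun A f" "(U, \<phi>) \<in> A"
  shows "line_holo (\<phi> ` U) (\<lambda>z. f (inv_into U \<phi> z))"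
  using assms holo_on_iff_line_holo[OF charted_chart(2)[OF assms(1,3)]] unfolding holomorphic_fun_def by blast

lemma holomorphic_fun_continuous:
  assumes A: "charted A" and f: "holomorphic_fun A f"
  shows "continuous_on UNIV f"
proof (rule continuous_at_imp_continuous_on, rule ballI)
  fix x
  obtain U \<phi> where U: "(U, \<phi>) \<in> A" "x \<in> U" by (rule charted_cover[OF A])
  have "continuous_on U (\<lambda>x. f (inv_into U \<phi> (\<phi> x)))"
    by (rule continuous_on_compose2[OF line_holo_continuous[OF holomorphic_fun_line_holo[OF A f U(1)]]
          charted_chart(3)[OF A U(1)]]) simp
  then have "continuous_on U f"
    by (rule continuous_on_eq) (simp add: charted_chart(5)[OF A U(1)])
  then show "isCont f x"
    using U(2) charted_chart(1)[OF A U(1)] by (simp add: continuous_on_eq_continuous_at)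
qed

text \<open>In charts \<open>U\<close> of \<open>Y\<close> and \<open>W\<close> of \<open>X\<close>
  this is the local result, on the open set \<open>D U \<phi> W\<close> where \<Phi> takes values in
  \<open>W\<close>. No chart of \<open>X\<close> occurs in the claim on \<omega>, so these sets are
  used to cover \<open>U\<close>.\<close>

theorem holomorphic_if_projectively_separating:
  fixes A :: "('a::t2_space, 'n::finite) atlas" and B :: "('b::t2_space, 'm::finite) atlas"
  assumes A: "charted A" and B: "charted B" and cont: "continuous_on UNIV \<Phi>"
    and \<omega>: "\<And>y. \<omega> y \<noteq> 0"
    and F: "\<And>f. f \<in> F \<Longrightarrow> holomorphic_fun A f"
    and W: "\<And>f. f \<in> F \<Longrightarrow> holomorphic_fun B (wcomp \<Phi> \<omega> f)"
    and nz: "\<And>x. \<exists>g\<in>F. g x \<noteq> 0"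
    and sep: "\<And>x y. x \<noteq> y \<Longrightarrow> \<exists>f\<in>F. \<exists>g\<in>F. f x * g y \<noteq> f y * g x"
  shows "holomorphic_map B A \<Phi>" "holomorphic_fun B \<omega>"
proof -
  define D where "D = (\<lambda>U (\<phi> :: 'b \<Rightarrow> complex^'m) W. \<phi> ` (U \<inter> \<Phi> -` W))"
  have local: "open (D U \<phi> W) \<and> line_holo (D U \<phi> W) (\<lambda>z. \<psi> (\<Phi> (inv_into U \<phi> z)) $ k) \<and>
      line_holo (D U \<phi> W) (\<lambda>z. \<omega> (inv_into U \<phi> z))"
    if U: "(U, \<phi>) \<in> B" and W': "(W, \<psi>) \<in> A" for U \<phi> W \<psi> k
  proof -
    note cU = charted_chart[OF B U] and cW = charted_chart[OF A W']
    have open_pre: "open (U \<inter> \<Phi> -` W)"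
      using cont cU(1) cW(1) by (metis open_Int open_vimage)
    have D_eq: "D U \<phi> W = \<phi> ` U \<inter> inv_into U \<phi> -` (U \<inter> \<Phi> -` W)"
      unfolding D_def using cU(5) by auto
    have openD: "open (D U \<phi> W)"
      unfolding D_eq by (rule continuous_open_preimage[OF cU(4,2) open_pre])
    have subD: "D U \<phi> W \<subseteq> \<phi> ` U" by (auto simp: D_def)
    have inD: "\<Phi> (inv_into U \<phi> z) \<in> W" if "z \<in> D U \<phi> W" for z
      using that D_eq by blast
    let ?\<Psi> = "\<lambda>z. \<psi> (\<Phi> (inv_into U \<phi> z))"
    have cont\<Psi>: "continuous_on (D U \<phi> W) ?\<Psi>"
    proof (rule continuous_on_compose2[OF cW(3)])
      show "continuous_on (D U \<phi> W) (\<lambda>z. \<Phi> (inv_into U \<phi> z))"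
        by (rule continuous_on_compose2[OF cont continuous_on_subset[OF cU(4) subD]]) simp
    qed (use inD in blast)
    have sub\<Psi>: "?\<Psi> ` D U \<phi> W \<subseteq> \<psi> ` W" using inD by blast
    let ?H = "(\<lambda>f x. f (inv_into W \<psi> x)) ` F"
    have line: "line_holo (\<psi> ` W) h" if "h \<in> ?H" for h
      using that holomorphic_fun_line_holo[OF A F W'] by blast
    have holo: "line_holo (D U \<phi> W) (\<lambda>z. \<omega> (inv_into U \<phi> z) * h (?\<Psi> z))" if "h \<in> ?H" for h
    proof -
      obtain f where f: "f \<in> F" "h = (\<lambda>x. f (inv_into W \<psi> x))" using \<open>h \<in> ?H\<close> by blast
      have "line_holo (D U \<phi> W) (\<lambda>z. wcomp \<Phi> \<omega> f (inv_into U \<phi> z))"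
        by (rule line_holo_subset[OF holomorphic_fun_line_holo[OF B W[OF f(1)] U] subD])
      moreover have "wcomp \<Phi> \<omega> f (inv_into U \<phi> z) = \<omega> (inv_into U \<phi> z) * h (?\<Psi> z)"
        if "z \<in> D U \<phi> W" for z
        using cW(5)[OF inD[OF that]] by (simp add: wcomp_def f(2))
      ultimately show ?thesis by (rule line_holo_transform)
    qed
    have nz': "\<exists>g\<in>?H. g x \<noteq> 0" for x
      unfolding bex_simps by (rule nz)
    have sep': "\<exists>f\<in>?H. \<exists>g\<in>?H. f x * g y \<noteq> f y * g x" if "x \<in> \<psi> ` W" "y \<in> \<psi> ` W" "x \<noteq> y" for x y
    proof -
      have "inv_into W \<psi> x \<noteq> inv_into W \<psi> y" using that inv_into_injective by metis
      from sep[OF this] show ?thesis unfolding bex_simps .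
    qed
    note separating = line_holo_if_projectively_separating[OF openD cW(2) cont\<Psi> sub\<Psi> \<omega> line holo nz' sep']
    show ?thesis
      by (intro conjI openD separating)
  qed
  show "holomorphic_map B A \<Phi>"
    unfolding holomorphic_map_def
    using cont local holo_on_iff_line_holo unfolding D_def by blast
  show "holomorphic_fun B \<omega>"
    unfolding holomorphic_fun_def
  proof (clarify)
    fix U \<phi> assume U: "(U, \<phi>) \<in> B"
    note cU = charted_chart[OF B U]
    have "line_holo (\<phi> ` U) (\<lambda>z. \<omega> (inv_into U \<phi> z))"
    proof (rule line_holo_local[OF cU(2)])
      fix z assume "z \<in> \<phi> ` U"
      then obtain y where y: "y \<in> U" "z = \<phi> y" by blast
      obtain W \<psi> where W': "(W, \<psi>) \<in> A" "\<Phi> y \<in> W" by (rule charted_cover[OF A])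
      then have "z \<in> D U \<phi> W" using y by (auto simp: D_def)
      then show "\<exists>S. open S \<and> z \<in> S \<and> line_holo S (\<lambda>z. \<omega> (inv_into U \<phi> z))"
        using local[OF U W'(1)] by blast
    qed
    then show "holo_on (\<phi> ` U) (\<lambda>z. \<omega> (inv_into U \<phi> z))"
      using holo_on_iff_line_holo[OF cU(2)] by blast
  qed
qed

section \<open>What the hypotheses on the function space say about points\<close>

lemma generates_topology_continuous:
  fixes \<Phi> :: "'b::topological_space \<Rightarrow> 'a::topological_space"
  assumes gen: "generates_topology F" and cont: "\<And>f. f \<in> F \<Longrightarrow> continuous_on UNIV (\<lambda>y. f (\<Phi> y))"
  shows "continuous_on UNIV \<Phi>"
proof -
  have "open (\<Phi> -` S)" if "generate_topology {f -` V | f V. f \<in> F \<and> open V} S" for S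
    using that
  proof induction
    case (Basis S)
    then obtain f V where "f \<in> F" "open V" "S = f -` V" by blast
    then show ?case using open_vimage[OF _ cont] by (auto simp: vimage_def)
  qed (auto simp: vimage_Union)
  then show ?thesis
    using gen unfolding generates_topology_def by (simp add: continuous_on_open_vimage)
qed

text \<open>Two points with the same values under \<open>F\<close> lie in the same sets of the
  generated topology, which a Hausdorff space does not allow.\<close>

lemma generates_topology_separates:
  fixes F :: "('a::t2_space \<Rightarrow> complex) set"
  assumes gen: "generates_topology F" and eq: "\<And>f. f \<in> F \<Longrightarrow> f x = f y"
  shows "x = y"
proof (rule ccontr)
  assume "x \<noteq> y"
  then obtain S where S: "open S" "x \<in> S" "y \<notin> S" using t1_space by metis
  have "x \<in> S \<longleftrightarrow> y \<in> S" if "generate_topology {f -` V | f V. f \<in> F \<and> open V} S" for S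
    using that
  proof induction
    case (Basis S)
    then obtain f V where "f \<in> F" "S = f -` V" by blast
    then show ?case using eq[OF \<open>f \<in> F\<close>] by simp
  qed auto
  then show False using S gen unfolding generates_topology_def by metis
qed

lemma two_independent_nonzero:
  assumes "two_independent F" "x \<noteq> y"
  shows "\<exists>g\<in>F. g x \<noteq> 0"
proof (rule ccontr)
  assume "\<not> ?thesis"
  then have "\<forall>f\<in>F. 1 * point_eval x f + 0 * point_eval y f = 0" by (simp add: point_eval_def)
  then show False using assms unfolding two_independent_def by (metis zero_neq_one)
qed

text \<open>If all these cross products agreed, \<open>g y\<close> and \<open>- g x\<close> would be
  the coefficients of a nontrivial relation for any \<open>g\<close> with
  \<open>g x \<noteq> 0\<close>.\<close>

lemma two_independent_separates:
  assumes F: "two_independent F" and "x \<noteq> y"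
  shows "\<exists>f\<in>F. \<exists>g\<in>F. f x * g y \<noteq> f y * g x"
proof (rule ccontr)
  assume *: "\<not> ?thesis"
  obtain g where g: "g \<in> F" "g x \<noteq> 0" using two_independent_nonzero[OF assms] by blast
  then have "\<forall>f\<in>F. g y * point_eval x f + (- g x) * point_eval y f = 0"
    using * by (simp add: point_eval_def mult.commute)
  then have "- g x = 0" using assms unfolding two_independent_def by blast
  then show False using g by simp
qed

section \<open>Continuity and boundedness of weighted composition operators\<close>

lemma normed_function_spaceD:
  assumes "normed_function_space F N"
  shows "(\<lambda>x. 0) \<in> F" "f \<in> F \<Longrightarrow> g \<in> F \<Longrightarrow> (\<lambda>x. f x - g x) \<in> F" "f \<in> F \<Longrightarrow> (\<lambda>x. c * f x) \<in> F"
    "f \<in> F \<Longrightarrow> 0 \<le> N f" "f \<in> F \<Longrightarrow> N f = 0 \<longleftrightarrow> f = (\<lambda>x. 0)"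
    "f \<in> F \<Longrightarrow> N (\<lambda>x. c * f x) = cmod c * N f"
proof -
  have add: "(\<lambda>x. f x + g x) \<in> F" if "f \<in> F" "g \<in> F" for f g
    using assms that unfolding normed_function_space_def by blast
  have scale: "(\<lambda>x. c * f x) \<in> F" if "f \<in> F" for c f
    using assms that unfolding normed_function_space_def by blast
  show "(\<lambda>x. f x - g x) \<in> F" if "f \<in> F" "g \<in> F"
    using add[OF that(1) scale[OF that(2), of "-1"]] by simp
qed (use assms in \<open>unfold normed_function_space_def, blast\<close>)+

text \<open>The functions of modulus less than 1 on \<open>K\<close> form a compact-open
  neighbourhood of 0, so the operator sends a norm ball into it; homogeneity turns this into a
  linear bound.\<close>

lemma wcomp_bounded_on_compact:
  fixes K :: "'b::t2_space set"
  assumes F: "nshf A F NF" and E: "nshf B E NE"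
    and T: "continuous_operator F NF E NE (wcomp \<Phi> \<omega>)" and K: "compact K"
  obtains C where "0 < C" "\<And>f y. f \<in> F \<Longrightarrow> y \<in> K \<Longrightarrow> cmod (wcomp \<Phi> \<omega> f y) \<le> C * NF f"
proof -
  have nF: "normed_function_space F NF" using F by (simp add: nshf_def)
  note nfs = normed_function_spaceD[OF nF]
  interpret Metric_space F "norm_dist F NF" by (rule Metric_space_norm_dist[OF nF])
  have top: "norm_topology F NF = mtopology" by (simp add: norm_topology_def)
  define S where "S = {h :: 'b \<Rightarrow> complex. continuous_on UNIV h \<and> h ` K \<subseteq> ball 0 1}"
  have "continuous_map (norm_topology F NF) compact_open_topology ((\<lambda>f. f) \<circ> wcomp \<Phi> \<omega>)"
    using T E unfolding continuous_operator_def nshf_def by (blast intro: continuous_map_compose)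
  moreover have "openin compact_open_topology S"
    unfolding compact_open_topology_def S_def using K by (intro topology_generated_by_Basis) blast
  ultimately have "openin mtopology {f \<in> F. wcomp \<Phi> \<omega> f \<in> S}"
    using openin_continuous_map_preimage[of mtopology compact_open_topology "wcomp \<Phi> \<omega>" S]
    by (simp add: top o_def)
  moreover have "(\<lambda>x. 0) \<in> {f \<in> F. wcomp \<Phi> \<omega> f \<in> S}"
    using nfs(1) by (auto simp: S_def wcomp_def)
  ultimately obtain r where r: "r > 0" "mball (\<lambda>x. 0) r \<subseteq> {f \<in> F. wcomp \<Phi> \<omega> f \<in> S}"
    unfolding openin_mtopology by blast
  show thesis
  proof (rule that[of "2 / r"])
    show "0 < 2 / r" using r by simp
    fix f y assume f: "f \<in> F" and y: "y \<in> K"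
    show "cmod (wcomp \<Phi> \<omega> f y) \<le> 2 / r * NF f"
    proof (cases "NF f = 0")
      case True
      then have "f = (\<lambda>x. 0)" using nfs(5)[OF f] by simp
      then have "wcomp \<Phi> \<omega> f y = 0" by (simp add: wcomp_def)
      then show ?thesis using True by simp
    next
      case False
      then have pos: "NF f > 0" using nfs(4)[OF f] by simp
      \<comment> \<open>Scales \<open>f\<close> to norm \<open>r / 2\<close>, strictly inside the
        ball, hence the constant \<open>2 / r\<close>. The sign in \<open>?g\<close> is undone by
        the subtraction in \<open>norm_dist\<close>.\<close>
      define c where "c = complex_of_real (r / (2 * NF f))"
      have c: "cmod c = r / (2 * NF f)"
        unfolding c_def norm_of_real using r pos by simp
      let ?g = "\<lambda>x. - c * f x"
      have g: "?g \<in> F" by (rule nfs(3)[OF f])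
      have "NF (\<lambda>x. 0 - ?g x) = cmod c * NF f"
        using nfs(6)[OF f, of c] by simp
      also have "\<dots> < r" using c r pos by simp
      finally have "?g \<in> mball (\<lambda>x. 0) r"
        using g nfs(1) by (simp add: norm_dist_def)
      then have "wcomp \<Phi> \<omega> ?g \<in> S" using r(2) by blast
      then have "wcomp \<Phi> \<omega> ?g y \<in> ball 0 1" unfolding S_def using y by blast
      then have "cmod (c * wcomp \<Phi> \<omega> f y) < 1" by (simp add: wcomp_def norm_mult mult_ac)
      then have "r / (2 * NF f) * cmod (wcomp \<Phi> \<omega> f y) < 1" by (simp only: norm_mult c)
      then show ?thesis using r pos by (simp add: field_simps)
    qed
  qed
qed

lemma charted_compact_neighbourhood:
  fixes B :: "('b::t2_space, 'm::finite) atlas" and y :: 'b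
  assumes B: "charted B"
  obtains N K where "open N" "y \<in> N" "N \<subseteq> K" "compact K"
proof -
  obtain U \<phi> where U: "(U, \<phi>) \<in> B" "y \<in> U" by (rule charted_cover[OF B])
  note c = charted_chart[OF B U(1)]
  obtain e where e: "e > 0" "cball (\<phi> y) e \<subseteq> \<phi> ` U"
    using c(2) U(2) open_contains_cball by blast
  show thesis
  proof (rule that[of "U \<inter> \<phi> -` ball (\<phi> y) e" "inv_into U \<phi> ` cball (\<phi> y) e"])
    show "open (U \<inter> \<phi> -` ball (\<phi> y) e)" by (rule continuous_open_preimage[OF c(3,1) open_ball])
    show "y \<in> U \<inter> \<phi> -` ball (\<phi> y) e" using U(2) e(1) by simp
    show "compact (inv_into U \<phi> ` cball (\<phi> y) e)"
      by (rule compact_continuous_image[OF continuous_on_subset[OF c(4) e(2)] compact_cball])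
    show "U \<inter> \<phi> -` ball (\<phi> y) e \<subseteq> inv_into U \<phi> ` cball (\<phi> y) e"
    proof
      fix x assume x: "x \<in> U \<inter> \<phi> -` ball (\<phi> y) e"
      then have "x = inv_into U \<phi> (\<phi> x)" using c(5)[of x] by simp
      moreover have "\<phi> x \<in> cball (\<phi> y) e" using x ball_subset_cball by blast
      ultimately show "x \<in> inv_into U \<phi> ` cball (\<phi> y) e" by (rule image_eqI)
    qed
  qed
qed

text \<open>If \<open>\<Phi>\<close> left every compact set near \<open>y\<close>, then \<open>\<omega>\<close> would be arbitrarily small there, because
  \<open>\<bar>\<omega>\<bar> * kappa (\<Phi> y)\<close> is locally bounded; then \<open>wcomp \<Phi> \<omega> f\<close> would vanish at \<open>y\<close> for bounded \<open>f\<close>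
  and, by density, for all \<open>f\<close>.\<close>

lemma locally_relatively_compact:
  fixes y :: "'b::t2_space"
  assumes B: "charted B"
    and F: "nshf A F NF" and E: "nshf B E NE" and T: "continuous_operator F NF E NE (wcomp \<Phi> \<omega>)"
    and dense: "bounded_functions_dense F NF" and kappa: "kappa_tends_to_infinity F NF"
    and \<omega>: "\<And>y. \<omega> y \<noteq> 0" and nz: "\<And>x. \<exists>g\<in>F. g x \<noteq> 0"
  shows "\<exists>N K. open N \<and> y \<in> N \<and> compact K \<and> \<Phi> ` N \<subseteq> K"
proof (rule ccontr)
  assume no: "\<not> ?thesis"
  have nF: "normed_function_space F NF" using F by (simp add: nshf_def)
  note nfs = normed_function_spaceD[OF nF]
  interpret Metric_space F "norm_dist F NF" by (rule Metric_space_norm_dist[OF nF])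
  let ?T = "wcomp \<Phi> \<omega>"
  obtain N K where N: "open N" "y \<in> N" "N \<subseteq> K" "compact K"
    by (rule charted_compact_neighbourhood[OF B])
  obtain C where C: "0 < C" "\<And>f y. f \<in> F \<Longrightarrow> y \<in> K \<Longrightarrow> cmod (?T f y) \<le> C * NF f"
    using wcomp_bounded_on_compact[OF F E T N(4)] by metis
  \<comment> \<open>The bound on \<open>K\<close> is uniform over the unit ball of \<open>F\<close>,
    so it survives the supremum that defines \<open>kappa\<close>.\<close>
  have \<omega>_kappa: "cmod (\<omega> y') * kappa F NF (\<Phi> y') \<le> C" if y': "y' \<in> N" for y'
  proof -
    have "kappa F NF (\<Phi> y') \<le> C / cmod (\<omega> y')"
      unfolding kappa_def dual_norm_def
    proof (rule cSUP_least)
      have "NF (\<lambda>x. 0) = 0" using nfs(5)[OF nfs(1)] by simp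
      then show "{f \<in> F. NF f \<le> 1} \<noteq> {}" using nfs(1) by force
      fix f assume f: "f \<in> {f \<in> F. NF f \<le> 1}"
      have "cmod (\<omega> y') * cmod (f (\<Phi> y')) \<le> C * NF f"
        using C(2)[of f y'] f y' N(3) by (auto simp: wcomp_def norm_mult)
      also have "\<dots> \<le> C * 1" using f C(1) by (intro mult_left_mono) auto
      finally show "cmod (point_eval (\<Phi> y') f) \<le> C / cmod (\<omega> y')"
        using \<omega>[of y'] by (simp add: point_eval_def field_simps)
    qed
    then show ?thesis using \<omega>[of y'] by (simp add: field_simps)
  qed
  have bounded0: "?T b y = 0" if b: "b \<in> F" "bounded (range b)" for b
  proof (rule ccontr)
    assume nz_b: "?T b y \<noteq> 0"
    obtain M where M: "0 < M" "\<And>x. cmod (b x) \<le> M"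
      using b(2) unfolding bounded_pos by blast
    define \<delta> where "\<delta> = cmod (?T b y) / 2"
    have \<delta>: "\<delta> > 0" using nz_b by (simp add: \<delta>_def)
    have "holomorphic_fun B (?T b)"
      using T E b(1) unfolding continuous_operator_def nshf_def by blast
    then have "continuous_on UNIV (\<lambda>y. cmod (?T b y))"
      by (intro continuous_intros holomorphic_fun_continuous[OF B])
    then have "open ((\<lambda>y. cmod (?T b y)) -` {\<delta><..})" by (intro open_vimage open_greaterThan)
    then have N1: "open (N \<inter> (\<lambda>y. cmod (?T b y)) -` {\<delta><..})" using N(1) by blast
    have y1: "y \<in> N \<inter> (\<lambda>y. cmod (?T b y)) -` {\<delta><..}"
      using N(2) nz_b by (simp add: \<delta>_def)
    \<comment> \<open>With \<open>kappa\<close> above \<open>R\<close> the modulus of \<omega> is at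
      most \<open>C / R\<close>, so a function bounded by \<open>M\<close> has image at most
      \<delta> there, whereas it exceeds \<delta> on the chosen neighbourhood of
      \<open>y\<close>.\<close>
    define R where "R = C * M / \<delta>"
    have "R > 0" using C M \<delta> by (simp add: R_def)
    then obtain K' where K': "compact K'" "\<And>x. x \<notin> K' \<Longrightarrow> kappa F NF x > R"
      using kappa unfolding kappa_tends_to_infinity_def by blast
    obtain y' where y': "y' \<in> N \<inter> (\<lambda>y. cmod (?T b y)) -` {\<delta><..}" "\<Phi> y' \<notin> K'"
      using no N1 y1 K'(1) by blast
    have "cmod (\<omega> y') * R \<le> cmod (\<omega> y') * kappa F NF (\<Phi> y')"
      by (rule mult_left_mono[OF less_imp_le[OF K'(2)[OF y'(2)]] norm_ge_zero])
    also have "\<dots> \<le> C" using \<omega>_kappa y'(1) by blast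
    finally have "cmod (\<omega> y') * M \<le> \<delta>"
      using C(1) M(1) \<delta> by (simp add: R_def field_simps)
    moreover have "cmod (?T b y') \<le> cmod (\<omega> y') * M"
      using M(2)[of "\<Phi> y'"] by (simp add: wcomp_def norm_mult mult_left_mono)
    ultimately show False using y'(1) by simp
  qed
  have "?T f y = 0" if f: "f \<in> F" for f
  proof -
    have "cmod (?T f y) \<le> e" if e: "e > 0" for e
    proof -
      have "f \<in> mtopology closure_of {f \<in> F. bounded (range f)}"
        using dense f by (simp add: bounded_functions_dense_def norm_topology_def)
      moreover have "e / C > 0" using e C(1) by simp
      ultimately obtain b where b: "b \<in> F" "bounded (range b)" "norm_dist F NF f b < e / C"
        unfolding metric_closure_of by auto
      have "cmod (?T (\<lambda>x. f x - b x) y) \<le> C * NF (\<lambda>x. f x - b x)"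
        using C(2)[OF nfs(2)[OF f b(1)]] N(2,3) by blast
      also have "\<dots> \<le> e" using b f C(1) by (simp add: norm_dist_def field_simps)
      also have "?T (\<lambda>x. f x - b x) y = ?T f y"
        using bounded0[OF b(1,2)] by (simp add: wcomp_def right_diff_distrib)
      finally show ?thesis .
    qed
    then show ?thesis using field_le_epsilon[of "cmod (?T f y)" 0] by simp
  qed
  then show False using nz[of "\<Phi> y"] \<omega>[of y] by (auto simp: wcomp_def)
qed

text \<open>The proportionality \<open>f (\<Phi> y) * T g y = g (\<Phi> y) * T f y\<close>, where \<open>T = wcomp \<Phi> \<omega>\<close>,
  pins down \<open>\<Phi> y\<close>, since \<open>T f\<close> and \<open>T g\<close> are continuous.\<close>

lemma continuous_if_projectively_separating:
  fixes \<Phi> :: "'b::t2_space \<Rightarrow> 'a::t2_space"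
  assumes \<omega>: "\<And>y. \<omega> y \<noteq> 0" and F: "\<And>f. f \<in> F \<Longrightarrow> continuous_on UNIV f"
    and T: "\<And>f. f \<in> F \<Longrightarrow> continuous_on UNIV (wcomp \<Phi> \<omega> f)"
    and sep: "\<And>x y. x \<noteq> y \<Longrightarrow> \<exists>f\<in>F. \<exists>g\<in>F. f x * g y \<noteq> f y * g x"
    and loc: "\<And>y. \<exists>N K. open N \<and> y \<in> N \<and> compact K \<and> \<Phi> ` N \<subseteq> K"
  shows "continuous_on UNIV \<Phi>"
proof (rule continuous_at_imp_continuous_on, rule ballI)
  fix y
  obtain N K where N: "open N" "y \<in> N" and K: "compact K" "\<Phi> ` N \<subseteq> K" using loc by metis
  have avoid: "\<exists>P Q. open P \<and> x \<in> P \<and> open Q \<and> y \<in> Q \<and> (\<forall>y'\<in>Q. \<Phi> y' \<notin> P)" if x: "x \<noteq> \<Phi> y" for x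
  proof -
    obtain f g where fg: "f \<in> F" "g \<in> F" "f x * g (\<Phi> y) \<noteq> f (\<Phi> y) * g x" using sep[OF x] by blast
    \<comment> \<open>\<open>q\<close> vanishes on the graph of \<Phi> but not at
      \<open>(y, x)\<close>, so some product neighbourhood \<open>Q \<times> P\<close> misses the
      graph.\<close>
    define q where "q = (\<lambda>p. f (snd p) * wcomp \<Phi> \<omega> g (fst p) - g (snd p) * wcomp \<Phi> \<omega> f (fst p))"
    have "continuous_on UNIV q"
      unfolding q_def
      by (intro continuous_intros continuous_on_compose2[OF F] continuous_on_compose2[OF T] fg) auto
    then have "open (q -` (- {0}))" by (intro open_vimage) auto
    moreover have "q (y, x) = \<omega> y * (f x * g (\<Phi> y) - f (\<Phi> y) * g x)"
      by (simp add: q_def wcomp_def algebra_simps)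
    then have "(y, x) \<in> q -` (- {0})" using fg(3) \<omega> by simp
    ultimately obtain Q P where QP: "open Q" "open P" "(y, x) \<in> Q \<times> P" "Q \<times> P \<subseteq> q -` (- {0})"
      by (rule open_prod_elim)
    have "\<Phi> y' \<notin> P" if "y' \<in> Q" for y'
    proof
      assume "\<Phi> y' \<in> P"
      then have "q (y', \<Phi> y') \<noteq> 0" using QP(4) that by blast
      then show False by (simp add: q_def wcomp_def)
    qed
    then show ?thesis using QP by blast
  qed
  show "isCont \<Phi> y"
    unfolding continuous_at_open
  proof (intro allI impI)
    fix U assume U: "open U \<and> \<Phi> y \<in> U"
    \<comment> \<open>A closed graph with locally relatively compact values gives continuity:
      finitely many of the avoided sets cover \<open>K - U\<close>, and the finite intersection of
      their partners is a neighbourhood of \<open>y\<close>.\<close>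
    have "compact (K - U)" using K(1) U by (intro compact_diff) auto
    define G where "G = {P. open P \<and> (\<exists>Q. open Q \<and> y \<in> Q \<and> (\<forall>y'\<in>Q. \<Phi> y' \<notin> P))}"
    have opens: "open P" if "P \<in> G" for P using that by (simp add: G_def)
    have cover: "K - U \<subseteq> \<Union>G"
    proof
      fix x assume "x \<in> K - U"
      then have "x \<noteq> \<Phi> y" using U by blast
      from avoid[OF this] show "x \<in> \<Union>G" unfolding G_def by blast
    qed
    obtain G' where G': "G' \<subseteq> G" "finite G'" "K - U \<subseteq> \<Union>G'"
      by (rule compactE[OF \<open>compact (K - U)\<close> cover opens])
    have "\<forall>P\<in>G'. \<exists>Q. open Q \<and> y \<in> Q \<and> (\<forall>y'\<in>Q. \<Phi> y' \<notin> P)" using G'(1) by (auto simp: G_def)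
    then obtain Q where Q: "\<And>P. P \<in> G' \<Longrightarrow> open (Q P) \<and> y \<in> Q P \<and> (\<forall>y'\<in>Q P. \<Phi> y' \<notin> P)"
      by metis
    have "open (N \<inter> (\<Inter>P\<in>G'. Q P))"
      by (intro open_Int open_INT N(1) G'(2) ballI conjunct1[OF Q])
    moreover have "y \<in> N \<inter> (\<Inter>P\<in>G'. Q P)"
      by (intro IntI INT_I N(2) conjunct1[OF conjunct2[OF Q]])
    moreover have "\<Phi> y' \<in> U" if y': "y' \<in> N \<inter> (\<Inter>P\<in>G'. Q P)" for y'
    proof (rule ccontr)
      assume "\<Phi> y' \<notin> U"
      then have "\<Phi> y' \<in> \<Union>G'" using K(2) y' by (intro subsetD[OF G'(3)]) auto
      then obtain P where P: "P \<in> G'" "\<Phi> y' \<in> P" by blast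
      then have "y' \<in> Q P" using y' by simp
      then show False using Q[OF P(1)] P(2) by simp
    qed
    ultimately show "\<exists>S. open S \<and> y \<in> S \<and> (\<forall>y'\<in>S. \<Phi> y' \<in> U)" by blast
  qed
qed

section \<open>Dimension zero, and the three parts of the theorem\<close>

text \<open>Within a single point the punctured neighbourhood filter is trivial, so 0 is a
  derivative of every map.\<close>

lemma holo_on_subset_singleton:
  assumes "S \<subseteq> {z}"
  shows "holo_on S f"
  unfolding holo_on_def
proof
  fix w assume "w \<in> S"
  then have "S = {w}" using assms by auto
  then have "(f has_derivative (\<lambda>v. 0)) (at w within S)"
    by (simp add: has_derivative_def at_within_def)
  then show "\<exists>D. (f has_derivative D) (at w within S) \<and> (\<forall>c v. D (c *s v) = c * D v)" by auto
qed

lemma holomorphic_on_point: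
  fixes B :: "('b::t2_space, 'm::finite) atlas" and A :: "('a::t2_space, 'n::finite) atlas"
  assumes pt: "(UNIV :: 'b set) = {y}" and charts: "\<forall>(U, \<phi>)\<in>B. \<phi> ` U \<subseteq> {0}"
  shows "holomorphic_map B A \<Phi>" "holomorphic_fun B \<omega>"
proof -
  have "holo_on (\<phi> ` S) f" if "(U, \<phi>) \<in> B" "S \<subseteq> U" for U \<phi> S f
    using charts that by (intro holo_on_subset_singleton[where z = 0]) blast
  then show "holomorphic_fun B \<omega>" "holomorphic_map B A \<Phi>"
    unfolding holomorphic_fun_def holomorphic_map_def by (auto simp: pt)
qed

lemma holomorphic_fun_const:
  assumes "charted A"
  shows "holomorphic_fun A (\<lambda>x. c)"
  unfolding holomorphic_fun_def
proof clarify
  fix U \<phi> assume "(U, \<phi>) \<in> A"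
  from holo_on_iff_line_holo[OF charted_chart(2)[OF assms this]]
  show "holo_on (\<phi> ` U) (\<lambda>z. c)" using line_holo_const by blast
qed

theorem theorem4p9:
  fixes A :: "('a::t2_space, 'n::finite) atlas"
    and B :: "('b::t2_space, 'm::finite) atlas"
    and F :: "('a \<Rightarrow> complex) set" and NF :: "('a \<Rightarrow> complex) \<Rightarrow> real"
    and E :: "('b \<Rightarrow> complex) set" and NE :: "('b \<Rightarrow> complex) \<Rightarrow> real"
    and \<Phi> :: "'b \<Rightarrow> 'a" and \<omega> :: "'b \<Rightarrow> complex"
  assumes "complex_manifold A" and "complex_manifold B"
    and "\<not> compact (UNIV :: 'a set)"
    and "nshf A F NF" and "nshf B E NE"
    and "\<And>y. \<omega> y \<noteq> 0"
  shows "(generates_topology F \<and> continuous_operator F NF E NE (comp_op \<Phi>)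
            \<longrightarrow> holomorphic_map B A \<Phi>) \<and>
         (two_independent F \<and> generates_topology F \<and> (\<exists>c. c \<noteq> 0 \<and> (\<lambda>x. c) \<in> F) \<and>
          continuous_operator F NF E NE (wcomp \<Phi> \<omega>)
            \<longrightarrow> holomorphically_induced B A F \<Phi> \<omega>) \<and>
         (two_independent F \<and> two_independent E \<and> bounded_functions_dense F NF \<and>
          kappa_tends_to_infinity F NF \<and> continuous_operator F NF E NE (wcomp \<Phi> \<omega>)
            \<longrightarrow> holomorphically_induced B A F \<Phi> \<omega>)"
proof (cases "charted B")
  case False
  then obtain y :: 'b where "UNIV = {y}" "\<forall>(U, \<phi>)\<in>B. \<phi> ` U \<subseteq> {0}"
    using complex_manifold_cases[OF assms(2)] by blast
  from holomorphic_on_point[OF this] show ?thesis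
    unfolding holomorphically_induced_def by blast
next
  case B: True
  \<comment> \<open>A one-point space is compact, so non-compactness rules out dimension zero for
    \<open>X\<close>.\<close>
  have ne: "UNIV \<noteq> {x}" for x :: 'a using assms(3) by (metis finite.emptyI finite_imp_compact finite_insert)
  then have A: "charted A" using complex_manifold_cases[OF assms(1)] by blast
  have F: "holomorphic_fun A f" if "f \<in> F" for f using assms(4) that by (simp add: nshf_def)
  have E: "holomorphic_fun B f" if "f \<in> E" for f using assms(5) that by (simp add: nshf_def)
  have W: "holomorphic_fun B (wcomp \<Phi> w f)"
    if "continuous_operator F NF E NE (wcomp \<Phi> w)" "f \<in> F" for w f
    using that E unfolding continuous_operator_def by blast
  have induced: "holomorphically_induced B A F \<Phi> \<omega>"
    if "continuous_on UNIV \<Phi>" "continuous_operator F NF E NE (wcomp \<Phi> \<omega>)"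
      "\<And>x. \<exists>g\<in>F. g x \<noteq> 0" "\<And>x y. x \<noteq> y \<Longrightarrow> \<exists>f\<in>F. \<exists>g\<in>F. f x * g y \<noteq> f y * g x"
    using holomorphic_if_projectively_separating[OF A B that(1) assms(6) F W[OF that(2)] that(3,4)]
    unfolding holomorphically_induced_def by blast
  show ?thesis
  proof (intro conjI impI; elim conjE)
    assume gen: "generates_topology F" and "continuous_operator F NF E NE (comp_op \<Phi>)"
    then have C: "holomorphic_fun B (wcomp \<Phi> (\<lambda>y. 1) f)" if "f \<in> F" for f
      using W that unfolding comp_op_def by blast
    have cont: "continuous_on UNIV \<Phi>"
      by (rule generates_topology_continuous[OF gen])
         (use holomorphic_fun_continuous[OF B C] in \<open>simp add: wcomp_def\<close>)
    \<comment> \<open>Paired with the constant 1, any \<open>f\<close> with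
      \<open>f x \<noteq> f y\<close> separates projectively. The constant need not lie in
      \<open>F\<close>; with weight 1 its image is constant, hence holomorphic.\<close>
    show "holomorphic_map B A \<Phi>"
    proof (rule holomorphic_if_projectively_separating[OF A B cont, where F = "insert (\<lambda>x. 1) F" and \<omega> = "\<lambda>y. 1"])
      show "\<exists>f\<in>insert (\<lambda>x. 1) F. \<exists>g\<in>insert (\<lambda>x. 1) F. f x * g y \<noteq> f y * g x" if "x \<noteq> y" for x y
        using generates_topology_separates[OF gen, of x y] that by auto
    qed (use F C holomorphic_fun_const[OF A] holomorphic_fun_const[OF B] in \<open>auto simp: wcomp_def\<close>)
  next
    assume ind: "two_independent F" and gen: "generates_topology F"
      and "\<exists>c. c \<noteq> 0 \<and> (\<lambda>x. c) \<in> F" and T: "continuous_operator F NF E NE (wcomp \<Phi> \<omega>)"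
    then obtain c where c: "c \<noteq> 0" "(\<lambda>x. c) \<in> F" by blast
    have W_cont: "continuous_on UNIV (wcomp \<Phi> \<omega> f)" if "f \<in> F" for f
      by (rule holomorphic_fun_continuous[OF B W[OF T that]])
    have cont: "continuous_on UNIV \<Phi>"
    proof (rule generates_topology_continuous[OF gen])
      fix f assume f: "f \<in> F"
      \<comment> \<open>The image of the constant \<open>c\<close> is \<open>c * \<omega>\<close>,
        which has no zeros; dividing by it removes the possibly discontinuous weight.\<close>
      have "continuous_on UNIV (\<lambda>y. c * (wcomp \<Phi> \<omega> f y / wcomp \<Phi> \<omega> (\<lambda>x. c) y))"
        by (intro continuous_intros W_cont f c) (simp add: wcomp_def c(1) assms(6))
      then show "continuous_on UNIV (\<lambda>y. f (\<Phi> y))"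
        using assms(6) c(1) by (simp add: wcomp_def)
    qed
    have "\<exists>g\<in>F. g x \<noteq> 0" for x
      using c(1) by (intro bexI[OF _ c(2)])
    then show "holomorphically_induced B A F \<Phi> \<omega>"
      by (rule induced[OF cont T _ two_independent_separates[OF ind]])
  next
    assume ind: "two_independent F" and dense: "bounded_functions_dense F NF"
      and kappa: "kappa_tends_to_infinity F NF" and T: "continuous_operator F NF E NE (wcomp \<Phi> \<omega>)"
    have nz: "\<exists>g\<in>F. g x \<noteq> 0" for x
    proof -
      \<comment> \<open>Independence speaks only of pairs of distinct points, so nonvanishing at
        \<open>x\<close> needs a second point.\<close>
      have "\<exists>y. x \<noteq> y" using ne[of x] by (metis UNIV_eq_I singletonI)
      then obtain y where "x \<noteq> y" ..
      then show ?thesis by (rule two_independent_nonzero[OF ind])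
    qed
    note sep = two_independent_separates[OF ind]
    have "continuous_on UNIV \<Phi>"
      by (rule continuous_if_projectively_separating[OF assms(6) holomorphic_fun_continuous[OF A F]
            holomorphic_fun_continuous[OF B W[OF T]] sep
            locally_relatively_compact[OF B assms(4,5) T dense kappa assms(6) nz]])
    then show "holomorphically_induced B A F \<Phi> \<omega>"
      by (rule induced[OF _ T nz sep])
  qed
qed

end
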